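(* Let $\theta>0$, $\beta>1$, $\gamma=1/\theta$, and let $X_1,X_2,\ldots$ be independent real-valued random variables, defined on the same probability space, with common cumulative distribution function $F$ the Pseudo-Lindley distribution function with parameters $\theta,\beta$. Let $k(n)$ be a sequence of positive integers with $k(n)<n$ such that $k(n)\rightarrow+\infty$ and $$\frac{k(n)^{3/4}}{\log n}\rightarrow 0 \quad\text{as } n\rightarrow+\infty.$$ Let $H_n=\frac{1}{k(n)}\sum_{j=1}^{k(n)} j\left(X_{n-j+1,n}-X_{n-j,n}\right)$ be the Hill estimator. Then, as $n\rightarrow+\infty$, $\sqrt{k(n)}\,(H_n-\gamma)$ converges in distribution to the normal law $\mathcal{N}(0,\gamma^2)$ with mean $0$ and variance $\gamma^2$.
   Context: The Pseudo-Lindley distribution with parameters $\theta>0$ and $\beta>1$ is the law on $\mathbb{R}$ with density $$f(x)=\frac{\theta(\beta-1+\theta x)e^{-\theta x}}{\beta}\,1_{(x\geq 0)},$$ equivalently, its distribution function satisfies $1-F(x)=\beta^{-1}(\beta+\theta x)e^{-\theta x}$ for $x\geq 0$. For each $n\geq 1$, $X_{1,n}\leq\cdots\leq X_{n,n}$ denote the order statistics of the sample $X_1,\ldots,X_n$. *)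

theory Defs
  imports "HOL-Probability.Probability" "HOL-Real_Asymp.Real_Asymp"
begin

definition pseudo_lindley_density :: "real \<Rightarrow> real \<Rightarrow> real \<Rightarrow> real" where
  "pseudo_lindley_density \<theta> \<beta> x =
     (if 0 \<le> x then \<theta> * (\<beta> - 1 + \<theta> * x) * exp (- \<theta> * x) / \<beta> else 0)"

definition pseudo_lindley :: "real \<Rightarrow> real \<Rightarrow> real measure" where
  "pseudo_lindley \<theta> \<beta> = density lborel (\<lambda>x. ennreal (pseudo_lindley_density \<theta> \<beta> x))"

text \<open>For \<open>1 \<le> i \<le> n\<close>, \<open>order_stat x n i\<close> is the \<open>i\<close>-th smallest of \<open>x 1, \<dots>, x n\<close>,
  counted with multiplicity; other values of \<open>i\<close> are meaningless.\<close>

definition order_stat :: "(nat \<Rightarrow> real) \<Rightarrow> nat \<Rightarrow> nat \<Rightarrow> real" where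
  "order_stat x n i = sort (map x [1..<Suc n]) ! (i - 1)"

text \<open>The spacings are those of the sample itself, not of its logarithms.\<close>

definition hill :: "(nat \<Rightarrow> real) \<Rightarrow> nat \<Rightarrow> nat \<Rightarrow> real" where
  "hill x n k =
     (1 / real k) * (\<Sum>j = 1..k. real j * (order_stat x n (n - j + 1) - order_stat x n (n - j)))"

lemma measurable_pseudo_lindley_density [measurable]:
  "pseudo_lindley_density \<theta> \<beta> \<in> borel_measurable borel"
  unfolding pseudo_lindley_density_def by measurable

lemma pseudo_lindley_density_nonneg:
  assumes "\<theta> > 0" "\<beta> > 1"
  shows "0 \<le> pseudo_lindley_density \<theta> \<beta> x"
  using assms by (simp add: pseudo_lindley_density_def)

lemma pseudo_lindley_antideriv:
  fixes \<theta> \<beta> x :: real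
  assumes "\<beta> > 1" "0 \<le> x"
  shows "((\<lambda>x. - (\<beta> + \<theta> * x) * exp (- \<theta> * x) / \<beta>) has_real_derivative
           pseudo_lindley_density \<theta> \<beta> x) (at x)"
  unfolding pseudo_lindley_density_def using assms
  by (auto intro!: derivative_eq_intros simp: field_simps)

lemma prob_space_pseudo_lindley:
  assumes "\<theta> > 0" "\<beta> > 1"
  shows "prob_space (pseudo_lindley \<theta> \<beta>)"
proof
  have lim: "((\<lambda>x. - (\<beta> + \<theta> * x) * exp (- \<theta> * x) / \<beta>) \<longlongrightarrow> 0) at_top"
    using assms by real_asymp
  have "emeasure (pseudo_lindley \<theta> \<beta>) (space (pseudo_lindley \<theta> \<beta>)) =
      (\<integral>\<^sup>+x. ennreal (pseudo_lindley_density \<theta> \<beta> x) * indicator {0..} x \<partial>lborel)"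
    unfolding pseudo_lindley_def
    by (auto simp: emeasure_density pseudo_lindley_density_def
        intro!: nn_integral_cong split: split_indicator)
  also have "\<dots> = ennreal (0 - (- (\<beta> + \<theta> * 0) * exp (- \<theta> * 0) / \<beta>))"
    using assms
    by (intro nn_integral_FTC_atLeast[OF _ _ _ lim] pseudo_lindley_antideriv
        pseudo_lindley_density_nonneg) auto
  finally show "emeasure (pseudo_lindley \<theta> \<beta>) (space (pseudo_lindley \<theta> \<beta>)) = 1"
    using assms by simp
qed

lemma cdf_pseudo_lindley:
  assumes "\<theta> > 0" "\<beta> > 1"
  shows "cdf (pseudo_lindley \<theta> \<beta>) x =
           (if 0 \<le> x then 1 - (\<beta> + \<theta> * x) * exp (- \<theta> * x) / \<beta> else 0)"
proof (cases "0 \<le> x")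
  case True
  have mono: "exp (- \<theta> * x) * (\<beta> + \<theta> * x) \<le> \<beta>"
  proof -
    have "\<beta> + \<theta> * x \<le> \<beta> * (1 + \<theta> * x)"
      using assms True mult_right_mono[of 1 \<beta> "\<theta> * x"] by (simp add: distrib_left)
    also have "\<dots> \<le> \<beta> * exp (\<theta> * x)"
      using assms by (intro mult_left_mono exp_ge_add_one_self) auto
    finally show ?thesis
      by (simp add: exp_minus field_simps)
  qed
  have "emeasure (pseudo_lindley \<theta> \<beta>) {..x} =
      (\<integral>\<^sup>+y. ennreal (pseudo_lindley_density \<theta> \<beta> y) * indicator {0..x} y \<partial>lborel)"
    unfolding pseudo_lindley_def
    by (auto simp: emeasure_density pseudo_lindley_density_def
        intro!: nn_integral_cong split: split_indicator)
  also have "\<dots> = ennreal (- (\<beta> + \<theta> * x) * exp (- \<theta> * x) / \<beta> -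
                           (- (\<beta> + \<theta> * 0) * exp (- \<theta> * 0) / \<beta>))"
    using assms True
    by (intro nn_integral_FTC_Icc DERIV_subset[OF pseudo_lindley_antideriv]
        pseudo_lindley_density_nonneg) (auto simp: has_field_derivative_at_within)
  also have "\<dots> = ennreal (1 - (\<beta> + \<theta> * x) * exp (- \<theta> * x) / \<beta>)"
    using assms by (simp add: field_simps)
  finally show ?thesis
    using True mono assms
    by (simp add: cdf_def measure_def field_simps)
next
  case False
  have "emeasure (pseudo_lindley \<theta> \<beta>) {..x} =
      (\<integral>\<^sup>+y. ennreal (pseudo_lindley_density \<theta> \<beta> y) * indicator {..x} y \<partial>lborel)"
    unfolding pseudo_lindley_def by (subst emeasure_density) auto
  also have "\<dots> = (\<integral>\<^sup>+y. 0 \<partial>(lborel :: real measure))"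
    using False
    by (intro nn_integral_cong) (auto simp: pseudo_lindley_density_def indicator_def)
  finally show ?thesis
    using False by (simp add: cdf_def measure_def)
qed

end

theory Submission
  imports Defs
begin

text \<open>
  The proof compares the sample with an exponential one. Let \<open>\<Lambda> x = - ln (1 - F x)\<close> be the cumulative
  hazard of the Pseudo-Lindley law, that is \<open>\<Lambda> x = \<theta> x - ln (1 + \<theta> x / \<beta>)\<close> for \<open>x \<ge> 0\<close>. The variables
  \<open>E i = \<Lambda> (X i)\<close> are independent and standard exponential
  (\<open>distributed_cumulative_hazard\<close>), and since \<open>\<Lambda>\<close> is increasing it maps the order statistics of the \<open>X i\<close>
  to those of the \<open>E i\<close>. The derivative of \<open>\<Lambda>\<close> is \<open>\<theta> (1 - 1 / (\<beta> + \<theta> x))\<close>. Hence, if \<open>v\<close> is any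
  positive lower bound of \<open>E\<close> at rank \<open>n - k\<close>, the Hill statistics \<open>H\<^sup>X\<close> and \<open>H\<^sup>E\<close> of the two samples satisfy

  \<open>\<gamma> H\<^sup>E \<le> H\<^sup>X \<le> \<gamma> (1 + 1 / v) H\<^sup>E\<close>

  (\<open>hill_cumulative_hazard_le\<close>, \<open>hill_le_hill_cumulative_hazard\<close>).

  For exponential variables the problem is exactly solvable: \<open>k H\<^sup>E\<close> has the law of a sum of \<open>k\<close>
  independent standard exponential variables (\<open>distr_hill_exponential\<close>), because \<open>k H\<^sup>E\<close> is the sum of the
  excesses of the \<open>k\<close> largest values over the next one, and by the memoryless property these
  excesses are again exponential, whichever indices carry the largest values. The central limit
  theorem for sums therefore gives the limit law of \<open>sqrt k (H\<^sup>E - 1)\<close>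
  (\<open>CLT_hill_exponential\<close>).

  It remains to see that the factor \<open>1 + 1 / v\<close> is harmless. With probability tending to \<open>1\<close> one can take
  \<open>v = ln n / 2\<close> (\<open>order_stat_exponential_at_log_scale\<close>), so that \<open>sqrt k / v\<close> tends to \<open>0\<close> by the growth
  condition on \<open>k\<close>, and the distribution functions of \<open>sqrt k (H\<^sup>X - \<gamma>)\<close> are squeezed between those of
  \<open>\<gamma> sqrt k (H\<^sup>E - 1)\<close> at nearby points (\<open>squeeze_shifted_cdfs\<close>).
\<close>

section \<open>Order statistics\<close>

text \<open>Counting the sample points below a level characterizes the order statistics without reference to
  sorting; measurability, the tail bound and the analysis of ranks below all go through this
  equivalence.\<close>

lemma order_stat_le_iff:
  assumes "1 \<le> i" "i \<le> n"
  shows "order_stat x n i \<le> t \<longleftrightarrow> i \<le> card {j\<in>{1..n}. x j \<le> t}"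
proof -
  define s where "s = sort (map x [1..<Suc n])"
  have len: "length s = n" by (simp add: s_def)
  have srt: "sorted s" unfolding s_def by (rule sorted_sort)
  have "card {j\<in>{1..n}. x j \<le> t} = card (set (filter (\<lambda>j. x j \<le> t) [1..<Suc n]))"
    by (rule arg_cong[where f = card]) auto
  also have "\<dots> = length (filter (\<lambda>v. v \<le> t) (map x [1..<Suc n]))"
    by (subst distinct_card) (auto simp del: upt_Suc simp: filter_map comp_def)
  also have "\<dots> = length (filter (\<lambda>v. v \<le> t) s)"
    by (simp add: s_def filter_sort del: upt_Suc)
  also have "\<dots> = card {m. m < n \<and> s ! m \<le> t}"
    by (simp add: length_filter_conv_card len)
  finally have *: "card {j\<in>{1..n}. x j \<le> t} = card {m. m < n \<and> s ! m \<le> t}" .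
  show ?thesis
  proof (cases "s ! (i - 1) \<le> t")
    case True
    have "{..<i} \<subseteq> {m. m < n \<and> s ! m \<le> t}"
    proof
      fix m assume "m \<in> {..<i}"
      then have "m < i" by auto
      then have "s ! m \<le> s ! (i - 1)"
        using assms len by (intro sorted_nth_mono[OF srt]) auto
      then show "m \<in> {m. m < n \<and> s ! m \<le> t}"
        using True \<open>m < i\<close> assms by auto
    qed
    then have "i \<le> card {m. m < n \<and> s ! m \<le> t}"
      using card_mono[of "{m. m < n \<and> s ! m \<le> t}" "{..<i}"] by auto
    with True * show ?thesis by (simp add: order_stat_def s_def)
  next
    case False
    have "{m. m < n \<and> s ! m \<le> t} \<subseteq> {..<i - 1}"
    proof
      fix m assume m: "m \<in> {m. m < n \<and> s ! m \<le> t}"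
      then have "\<not> i - 1 \<le> m"
        using False len sorted_nth_mono[OF srt, of "i - 1" m] by auto
      then show "m \<in> {..<i - 1}" by auto
    qed
    then have "card {m. m < n \<and> s ! m \<le> t} < i"
      using card_mono[of "{..<i - 1}" "{m. m < n \<and> s ! m \<le> t}"] assms by auto
    with False * show ?thesis by (simp add: order_stat_def s_def)
  qed
qed

lemma order_stat_mono:
  assumes "i \<le> j" "1 \<le> i" "j \<le> n"
  shows "order_stat x n i \<le> order_stat x n j"
  unfolding order_stat_def using assms by (intro sorted_nth_mono) auto

lemma order_stat_in_sample:
  assumes "1 \<le> i" "i \<le> n"
  obtains j where "j \<in> {1..n}" "order_stat x n i = x j"
proof -
  have "order_stat x n i \<in> set (sort (map x [1..<Suc n]))"
    unfolding order_stat_def using assms by (intro nth_mem) auto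
  then obtain j where "j \<in> {1..n}" "order_stat x n i = x j"
    by (auto simp del: upt_Suc simp: less_Suc_eq_le)
  then show ?thesis by (rule that)
qed

lemma order_stat_mono_transform:
  assumes "mono f" "1 \<le> i" "i \<le> n"
  shows "order_stat (\<lambda>j. f (x j)) n i = f (order_stat x n i)"
proof -
  have "sort (map (\<lambda>j. f (x j)) [1..<Suc n]) = map f (sort (map x [1..<Suc n]))"
  proof (rule properties_for_sort)
    show "mset (map f (sort (map x [1..<Suc n]))) = mset (map (\<lambda>j. f (x j)) [1..<Suc n])"
      by (simp del: upt_Suc add: image_mset.compositionality comp_def)
    show "sorted (map f (sort (map x [1..<Suc n])))"
      unfolding sorted_map
      by (rule sorted_wrt_mono_rel[OF _ sorted_sort]) (rule monoD[OF assms(1)])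
  qed
  then show ?thesis
    unfolding order_stat_def using assms by (simp del: upt_Suc)
qed

lemma borel_measurable_order_stat:
  assumes X: "\<And>j. j \<in> {1..n} \<Longrightarrow> X j \<in> borel_measurable N" and i: "1 \<le> i" "i \<le> n"
  shows "(\<lambda>\<omega>. order_stat (\<lambda>j. X j \<omega>) n i) \<in> borel_measurable N"
proof (subst borel_measurable_iff_le, intro allI)
  fix t
  have "card {j\<in>{1..n}. X j \<omega> \<le> t} = (\<Sum>j\<in>{1..n}. if X j \<omega> \<le> t then 1 else 0)" for \<omega>
    by (simp add: sum.If_cases Int_def)
  then have "{\<omega>\<in>space N. order_stat (\<lambda>j. X j \<omega>) n i \<le> t} =
      {\<omega>\<in>space N. i \<le> (\<Sum>j\<in>{1..n}. if X j \<omega> \<le> t then 1 else (0::nat))}"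
    using order_stat_le_iff[OF i] by auto
  also have "\<dots> \<in> sets N"
  proof -
    have [measurable]: "(\<lambda>\<omega>. \<Sum>j\<in>{1..n}. if X j \<omega> \<le> t then 1 else (0::nat)) \<in> N \<rightarrow>\<^sub>M count_space UNIV"
    proof (intro measurable_sum_nat)
      fix j assume "j \<in> {1..n}"
      then have [measurable]: "X j \<in> borel_measurable N" by (rule X)
      show "(\<lambda>\<omega>. if X j \<omega> \<le> t then 1 else (0::nat)) \<in> N \<rightarrow>\<^sub>M count_space UNIV" by measurable
    qed
    show ?thesis by measurable
  qed
  finally show "{\<omega>\<in>space N. order_stat (\<lambda>j. X j \<omega>) n i \<le> t} \<in> sets N" .
qed

lemma borel_measurable_hill:
  assumes X: "\<And>j. j \<in> {1..n} \<Longrightarrow> X j \<in> borel_measurable N" and k: "k < n"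
  shows "(\<lambda>\<omega>. hill (\<lambda>j. X j \<omega>) n k) \<in> borel_measurable N"
  unfolding hill_def using k
  by (intro borel_measurable_times borel_measurable_const borel_measurable_sum
      borel_measurable_diff borel_measurable_order_stat[OF X]) auto

lemma sum_weighted_spacings:
  fixes f :: "nat \<Rightarrow> real"
  shows "(\<Sum>j=1..k. real j * (f (j - 1) - f j)) = (\<Sum>j<k. f j - f k)"
  by (induction k) (auto simp: algebra_simps sum_subtractf)

text \<open>Summation by parts turns the weighted spacings into the sum of the excesses of the \<open>k\<close> largest
  values over the next one. Written with positive parts it becomes a symmetric function of the sample
  and the threshold, so the sorted list can be exchanged for the sample.\<close>

lemma hill_eq_sum_excesses:
  assumes "1 \<le> k" "k < n"
  shows "real k * hill x n k = (\<Sum>j\<in>{1..n}. max (x j - order_stat x n (n - k)) 0)"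
proof -
  define s where "s = sort (map x [1..<Suc n])"
  define u where "u = s ! (n - k - 1)"
  have len: "length s = n" by (simp add: s_def)
  have srt: "sorted s" unfolding s_def by (rule sorted_sort)
  have u: "order_stat x n (n - k) = u" by (simp add: order_stat_def s_def u_def)
  have "real k * hill x n k = (\<Sum>j=1..k. real j * (s ! (n - 1 - (j - 1)) - s ! (n - 1 - j)))"
    using assms unfolding hill_def order_stat_def s_def[symmetric]
    by (auto simp: s_def[symmetric] intro!: sum.cong arg_cong2[where f = "(-)"] arg_cong[where f = "nth s"])
  also have "\<dots> = (\<Sum>j<k. s ! (n - 1 - j) - s ! (n - 1 - k))"
    by (rule sum_weighted_spacings)
  also have "\<dots> = (\<Sum>m\<in>{n - k..<n}. s ! m - u)"
    using assms
    by (intro sum.reindex_bij_witness[of _ "\<lambda>m. n - 1 - m" "\<lambda>j. n - 1 - j"]) (auto simp: u_def)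
  also have "\<dots> = (\<Sum>m\<in>{n - k..<n}. max (s ! m - u) 0)"
    using assms len sorted_nth_mono[OF srt, of "n - k - 1"]
    by (intro sum.cong) (auto simp: u_def)
  also have "\<dots> = (\<Sum>m\<in>{0..<n}. max (s ! m - u) 0)"
    using assms len sorted_nth_mono[OF srt, of _ "n - k - 1"]
    by (intro sum.mono_neutral_left) (auto simp: u_def)
  also have "\<dots> = sum_list (map (\<lambda>v. max (v - u) 0) s)"
    by (simp add: sum_list_sum_nth len)
  also have "\<dots> = sum_list (map (\<lambda>v. max (v - u) 0) (map x [1..<Suc n]))"
    unfolding sum_mset_sum_list[symmetric] mset_map by (simp add: s_def del: upt_Suc)
  also have "\<dots> = (\<Sum>j\<in>{1..n}. max (x j - u) 0)"
    by (simp del: upt_Suc add: comp_def interv_sum_list_conv_sum_set_nat atLeastLessThanSuc_atLeastAtMost)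
  finally show ?thesis by (simp add: u)
qed

text \<open>In a sample without ties exactly one pair \<open>(i, S)\<close> describes the top of the sample: \<open>i\<close> is the
  index of the threshold and \<open>S\<close> collects the \<open>k\<close> indices above it. The conditions in the last
  clause involve only comparisons with \<open>x i\<close>, which is what makes it possible to integrate over the
  coordinates in \<open>S\<close> separately.\<close>

lemma ex1_top_set_of_distinct_sample:
  assumes inj: "inj_on x {1..n}" and k: "1 \<le> k" "k < n"
  defines "u \<equiv> order_stat x n (n - k)"
  obtains i S where "i \<in> {1..n}" "S \<subseteq> {1..n} - {i}" "card S = k" "x i = u"
    "S = {j\<in>{1..n}. u < x j}"
    "\<And>i' S'. i' \<in> {1..n} \<Longrightarrow> S' \<subseteq> {1..n} - {i'} \<Longrightarrow> card S' = k \<Longrightarrow>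
       (\<forall>j\<in>S'. x i' < x j) \<and> (\<forall>j\<in>{1..n} - S' - {i'}. x j < x i') \<longleftrightarrow> i' = i \<and> S' = S"
proof -
  have ord: "u \<le> t \<longleftrightarrow> n - k \<le> card {j\<in>{1..n}. x j \<le> t}" for t
    unfolding u_def using k by (intro order_stat_le_iff) auto
  obtain i where i: "i \<in> {1..n}" "x i = u"
    unfolding u_def by (rule order_stat_in_sample[of "n - k" n x]) (use k in auto)
  define S where "S = {j\<in>{1..n}. u < x j}"
  have Si: "S \<subseteq> {1..n} - {i}" using i by (auto simp: S_def)
  have fin: "finite S" by (simp add: S_def)
  have le: "{j\<in>{1..n}. x j \<le> u} = {1..n} - S" by (auto simp: S_def)
  have cS: "card S = k"
  proof -
    have "n - k \<le> card {j\<in>{1..n}. x j \<le> u}" using ord[of u] by blast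
    then have "n - k \<le> n - card S"
      unfolding le using Si fin by (subst (asm) card_Diff_subset) auto
    moreover have "card S \<le> card ({1..n} - {i})" using Si by (intro card_mono) auto
    then have "card S < n" using i k by auto
    ultimately have a: "card S \<le> k" using k by linarith
    have "k \<le> card S"
    proof (rule ccontr)
      \<comment> \<open>If too few points exceed \<open>u\<close>, the points strictly below \<open>u\<close> already number \<open>n - k\<close>, and
        their maximum contradicts the minimality of \<open>u\<close>.\<close>
      assume less: "\<not> k \<le> card S"
      define L where "L = {1..n} - S - {i}"
      have L: "x j < u" if "j \<in> L" for j
      proof -
        have "x j \<noteq> x i"
          using that inj_onD[OF inj, of j i] i by (auto simp: L_def)
        moreover have "x j \<le> u" using that by (auto simp: L_def S_def not_less)
        ultimately show ?thesis using i(2) by linarith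
      qed
      have cL: "card L = n - card S - 1"
      proof -
        have "i \<in> {1..n} - S" using i Si by blast
        then have "card L = card ({1..n} - S) - 1" unfolding L_def by (rule card_Diff_singleton)
        also have "card ({1..n} - S) = n - card S" using Si fin by (subst card_Diff_subset) auto
        finally show ?thesis .
      qed
      then have "card L > 0" using less k by linarith
      then have ne: "L \<noteq> {}" by auto
      have finL: "finite L" by (simp add: L_def)
      define t where "t = Max (x ` L)"
      have "t < u" unfolding t_def using L ne finL by auto
      moreover have "L \<subseteq> {j\<in>{1..n}. x j \<le> t}"
        unfolding t_def using finL by (auto simp: L_def)
      then have "card L \<le> card {j\<in>{1..n}. x j \<le> t}" by (intro card_mono) auto
      then have "u \<le> t" using ord cL less k by auto
      ultimately show False by simp
    qed
    with a show ?thesis by simp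
  qed
  have uniq: "i' = i \<and> S' = S"
    if i': "i' \<in> {1..n}" and S': "S' \<subseteq> {1..n} - {i'}" "card S' = k"
      and up: "\<forall>j\<in>S'. x i' < x j" and down: "\<forall>j\<in>{1..n} - S' - {i'}. x j < x i'" for i' S'
  proof -
    have finS': "finite S'" using S' finite_subset by blast
    have "x i' = u"
    proof (rule antisym)
      have "{1..n} - S' \<subseteq> {j\<in>{1..n}. x j \<le> x i'}"
      proof
        fix j assume "j \<in> {1..n} - S'"
        then show "j \<in> {j\<in>{1..n}. x j \<le> x i'}"
          using down by (cases "j = i'") (auto intro: less_imp_le)
      qed
      then have "card ({1..n} - S') \<le> card {j\<in>{1..n}. x j \<le> x i'}" by (intro card_mono) auto
      moreover have "card ({1..n} - S') = n - k" using S' finS' by (subst card_Diff_subset) auto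
      ultimately show "u \<le> x i'" using ord by simp
      show "x i' \<le> u"
      proof (rule ccontr)
        assume "\<not> x i' \<le> u"
        then have "{j\<in>{1..n}. x j \<le> u} \<subseteq> {1..n} - S' - {i'}"
          using up by (auto dest: less_imp_le bspec simp: not_le)
        then have "card {j\<in>{1..n}. x j \<le> u} \<le> card ({1..n} - S' - {i'})" by (intro card_mono) auto
        also have "\<dots> = card ({1..n} - S') - 1" using i' S' by (intro card_Diff_singleton) blast
        also have "card ({1..n} - S') = n - k" using S' finS' by (subst card_Diff_subset) auto
        finally show False using ord[of u] k by simp
      qed
    qed
    then have "i' = i" using inj_onD[OF inj, of i' i] i i' by simp
    moreover have "S' = S"
    proof
      show "S' \<subseteq> S" using up S' \<open>x i' = u\<close> by (auto simp: S_def)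
      show "S \<subseteq> S'"
      proof
        fix j assume "j \<in> S"
        then have "j \<in> {1..n}" "\<not> x j < x i'" "j \<noteq> i'"
          using \<open>x i' = u\<close> by (auto simp: S_def)
        then show "j \<in> S'" using down by blast
      qed
    qed
    ultimately show ?thesis by simp
  qed
  have ex: "(\<forall>j\<in>S. x i < x j) \<and> (\<forall>j\<in>{1..n} - S - {i}. x j < x i)"
  proof (intro conjI ballI)
    fix j assume j: "j \<in> {1..n} - S - {i}"
    then have "x j \<noteq> x i" using inj_onD[OF inj, of j i] i by auto
    moreover have "x j \<le> u" using j by (auto simp: S_def not_less)
    ultimately show "x j < x i" using i(2) by linarith
  qed (use i in \<open>auto simp: S_def\<close>)
  show ?thesis
    by (rule that[of i S]) (use i Si cS S_def uniq ex in blast)+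
qed

section \<open>The memoryless property in several dimensions\<close>

definition exp_law :: "real measure" where
  "exp_law = density lborel (\<lambda>x. ennreal (exponential_density 1 x))"

lemma sets_exp_law [measurable_cong, simp]: "sets exp_law = sets borel"
  by (simp add: exp_law_def)

lemma space_exp_law [simp]: "space exp_law = UNIV"
  by (simp add: exp_law_def)

lemma prob_space_exp_law: "prob_space exp_law"
  unfolding exp_law_def by (rule prob_space_exponential_density) simp

lemma AE_exp_law_nonneg: "AE x in exp_law. 0 \<le> x"
  unfolding exp_law_def by (subst AE_density) (auto simp: exponential_density_def)

lemma AE_exp_law_neq: "AE x in exp_law. x \<noteq> c"
  unfolding exp_law_def using AE_lborel_singleton[of c] by (subst AE_density) auto

interpretation exp_law: prob_space exp_law
  by (rule prob_space_exp_law)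

interpretation exp_prod: product_sigma_finite "\<lambda>_. exp_law"
  by standard

lemma exp_law_memoryless:
  assumes g [measurable]: "g \<in> borel_measurable borel" and t: "0 \<le> t"
  shows "(\<integral>\<^sup>+y. (if t < y then 1 else 0) * g (y - t) \<partial>exp_law) =
    ennreal (exp (- t)) * (\<integral>\<^sup>+y. g y \<partial>exp_law)"
proof -
  have "(\<integral>\<^sup>+y. (if t < y then 1 else 0) * g (y - t) \<partial>exp_law) =
      (\<integral>\<^sup>+y. ennreal (exponential_density 1 y) * ((if t < y then 1 else 0) * g (y - t)) \<partial>lborel)"
    unfolding exp_law_def by (intro nn_integral_density) auto
  also have "\<dots> = (\<integral>\<^sup>+y. ennreal (exponential_density 1 (t + y)) * ((if 0 < y then 1 else 0) * g y) \<partial>lborel)"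
    by (subst nn_integral_real_affine[where c = 1 and t = t]) auto
  also have "\<dots> = (\<integral>\<^sup>+y. ennreal (exp (- t)) * (ennreal (exponential_density 1 y) * g y) \<partial>lborel)"
    using AE_lborel_singleton[of "0::real"] t
    by (intro nn_integral_cong_AE)
      (auto elim!: eventually_mono
        simp: exponential_density_def exp_add[symmetric] ennreal_mult[symmetric] mult.assoc[symmetric] mult_exp_exp)
  also have "\<dots> = ennreal (exp (- t)) * (\<integral>\<^sup>+y. g y \<partial>exp_law)"
    unfolding exp_law_def by (simp add: nn_integral_cmult nn_integral_density)
  finally show ?thesis .
qed

text \<open>Given that all coordinates exceed \<open>t\<close>, the excesses over \<open>t\<close> are again independent standard
  exponential variables. The function \<open>h\<close> is arbitrary, so that in the induction the new
  coordinate can be absorbed into it as a shift of its argument.\<close>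

lemma exp_law_memoryless_PiM:
  assumes "finite S" "h \<in> borel_measurable borel" and t: "0 \<le> t"
  shows "(\<integral>\<^sup>+y. (\<Prod>j\<in>S. if t < y j then 1 else 0) * h (\<Sum>j\<in>S. y j - t) \<partial>PiM S (\<lambda>_. exp_law)) =
    ennreal (exp (- t)) ^ card S * (\<integral>\<^sup>+y. h (\<Sum>j\<in>S. y j) \<partial>PiM S (\<lambda>_. exp_law))"
  using assms(1,2)
proof (induction S arbitrary: h)
  case empty
  then show ?case by simp
next
  case (insert a S h)
  note [measurable] = insert.prems
  let ?P = "PiM S (\<lambda>_. exp_law)"
  interpret P: sigma_finite_measure ?P
    by (rule exp_prod.sigma_finite[OF insert.hyps(1)])
  have [simp]: "(\<Prod>j\<in>S. if t < (x(a := y)) j then 1 else (0::ennreal)) = (\<Prod>j\<in>S. if t < x j then 1 else 0)"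
    "(\<Sum>j\<in>S. (x(a := y)) j - t) = (\<Sum>j\<in>S. x j - t)" "sum (x(a := y)) S = sum x S" for x y
    using insert.hyps by (auto intro!: prod.cong sum.cong)
  have "(\<integral>\<^sup>+y. (\<Prod>j\<in>insert a S. if t < y j then 1 else 0) * h (\<Sum>j\<in>insert a S. y j - t)
        \<partial>PiM (insert a S) (\<lambda>_. exp_law)) =
      (\<integral>\<^sup>+y. (\<integral>\<^sup>+x. (if t < y then 1 else 0) *
         ((\<Prod>j\<in>S. if t < x j then 1 else 0) * h ((y - t) + (\<Sum>j\<in>S. x j - t))) \<partial>?P) \<partial>exp_law)"
    using insert.hyps
    by (subst exp_prod.product_nn_integral_insert_rev) (auto simp: mult.assoc simp del: fun_upd_apply simp add: fun_upd_same)
  also have "\<dots> = (\<integral>\<^sup>+y. (if t < y then 1 else 0) *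
         (\<integral>\<^sup>+x. (\<Prod>j\<in>S. if t < x j then 1 else 0) * h ((y - t) + (\<Sum>j\<in>S. x j - t)) \<partial>?P) \<partial>exp_law)"
    by (intro nn_integral_cong nn_integral_cmult) measurable
  also have "\<dots> = (\<integral>\<^sup>+y. (if t < y then 1 else 0) *
         (ennreal (exp (- t)) ^ card S * (\<integral>\<^sup>+x. h ((y - t) + (\<Sum>j\<in>S. x j)) \<partial>?P)) \<partial>exp_law)"
    by (intro nn_integral_cong arg_cong2[where f = "(*)"] refl insert.IH[of "\<lambda>u. h (_ + u)"]) measurable
  also have "\<dots> = ennreal (exp (- t)) *
      (\<integral>\<^sup>+y. ennreal (exp (- t)) ^ card S * (\<integral>\<^sup>+x. h (y + (\<Sum>j\<in>S. x j)) \<partial>?P) \<partial>exp_law)"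
    by (rule exp_law_memoryless[OF _ t]) measurable
  also have "\<dots> = ennreal (exp (- t)) ^ card (insert a S) *
      (\<integral>\<^sup>+y. (\<integral>\<^sup>+x. h (y + (\<Sum>j\<in>S. x j)) \<partial>?P) \<partial>exp_law)"
    using insert.hyps by (subst nn_integral_cmult) (auto simp: mult.assoc)
  also have "(\<integral>\<^sup>+y. (\<integral>\<^sup>+x. h (y + (\<Sum>j\<in>S. x j)) \<partial>?P) \<partial>exp_law) =
      (\<integral>\<^sup>+y. h (\<Sum>j\<in>insert a S. y j) \<partial>PiM (insert a S) (\<lambda>_. exp_law))"
    using insert.hyps
    by (subst exp_prod.product_nn_integral_insert_rev)
      (auto simp del: fun_upd_apply simp add: fun_upd_same)
  finally show ?case .
qed

text \<open>On the event that exactly the coordinates in \<open>S\<close> exceed the coordinate \<open>i\<close>, integrating first over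
  the coordinates in \<open>S\<close> applies the memoryless property with threshold \<open>y i\<close>. The factor
  \<open>exp (- y i) ^ card S\<close> thus produced is left unevaluated: it depends on the coordinates in \<open>J\<close>
  only, and taking \<open>h\<close> constant identifies its integral with the probability of the event.\<close>

lemma excess_integral_factorizes:
  assumes fin: "finite S" "finite J" and iJ: "i \<in> J" and disj: "J \<inter> S = {}"
    and h [measurable]: "h \<in> borel_measurable borel"
  defines "evt \<equiv> \<lambda>y. (\<Prod>j\<in>S. if y i < y j then 1 else 0) * (\<Prod>j\<in>J - {i}. if y j < y i then 1 else (0::ennreal))"
  shows "(\<integral>\<^sup>+y. evt y * h (\<Sum>j\<in>S. y j - y i) \<partial>PiM (J \<union> S) (\<lambda>_. exp_law)) =
    (\<integral>\<^sup>+y. evt y \<partial>PiM (J \<union> S) (\<lambda>_. exp_law)) * (\<integral>\<^sup>+y. h (\<Sum>j\<in>S. y j) \<partial>PiM S (\<lambda>_. exp_law))"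
proof -
  let ?J = "PiM J (\<lambda>_. exp_law)" and ?S = "PiM S (\<lambda>_. exp_law)"
  define w where "w = (\<lambda>x. ennreal (exp (- x i)) ^ card S * (\<Prod>j\<in>J - {i}. if x j < x i then 1 else (0::ennreal)))"
  have [measurable]: "w \<in> borel_measurable ?J"
    using iJ unfolding w_def by measurable
  have fold: "(\<integral>\<^sup>+y. evt y * g (\<Sum>j\<in>S. y j - y i) \<partial>PiM (J \<union> S) (\<lambda>_. exp_law)) =
      (\<integral>\<^sup>+x. w x \<partial>?J) * (\<integral>\<^sup>+y. g (\<Sum>j\<in>S. y j) \<partial>?S)"
    if g [measurable]: "g \<in> borel_measurable borel" for g
  proof -
    have [measurable]: "(\<lambda>y. evt y * g (\<Sum>j\<in>S. y j - y i)) \<in> borel_measurable (PiM (J \<union> S) (\<lambda>_. exp_law))"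
    proof -
      have comp: "(\<lambda>y. y j) \<in> borel_measurable (PiM (J \<union> S) (\<lambda>_. exp_law))" if "j \<in> J \<union> S" for j
        using that by measurable
      have [measurable]: "(\<lambda>y. y i) \<in> borel_measurable (PiM (J \<union> S) (\<lambda>_. exp_law))"
        using iJ by (intro comp) auto
      have less: "(\<lambda>y. if y j < y l then 1 else (0::ennreal)) \<in> borel_measurable (PiM (J \<union> S) (\<lambda>_. exp_law))"
        if "j \<in> J \<union> S" "l \<in> J \<union> S" for j l
        using comp[OF that(1), measurable] comp[OF that(2), measurable] by measurable
      have [measurable]: "(\<lambda>y. \<Sum>j\<in>S. y j - y i) \<in> borel_measurable (PiM (J \<union> S) (\<lambda>_. exp_law))"
        by (intro borel_measurable_sum borel_measurable_diff comp) (use iJ in auto)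
      have [measurable]: "evt \<in> borel_measurable (PiM (J \<union> S) (\<lambda>_. exp_law))"
        unfolding evt_def
        by (intro borel_measurable_times_ennreal borel_measurable_prod_ennreal less) (use iJ in auto)
      show ?thesis by measurable
    qed
    have mJ: "merge J S (x, y) j = x j" if "j \<in> J" for x y :: "_ \<Rightarrow> real" and j
      using that by (simp add: merge_def)
    have mS: "merge J S (x, y) j = y j" if "j \<in> S" for x y :: "_ \<Rightarrow> real" and j
      using that disj by (auto simp: merge_def)
    have "(\<integral>\<^sup>+y. evt y * g (\<Sum>j\<in>S. y j - y i) \<partial>PiM (J \<union> S) (\<lambda>_. exp_law)) =
        (\<integral>\<^sup>+x. (\<integral>\<^sup>+y. (\<Prod>j\<in>J - {i}. if x j < x i then 1 else 0) *
          ((\<Prod>j\<in>S. if x i < y j then 1 else 0) * g (\<Sum>j\<in>S. y j - x i)) \<partial>?S) \<partial>?J)"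
      using fin disj iJ
      by (subst exp_prod.product_nn_integral_fold)
        (auto simp: evt_def mJ mS mult_ac intro!: nn_integral_cong)
    also have "\<dots> = (\<integral>\<^sup>+x. w x * (\<integral>\<^sup>+y. g (\<Sum>j\<in>S. y j) \<partial>?S) \<partial>?J)"
    proof (rule nn_integral_cong_AE)
      have "AE x in ?J. 0 \<le> x i"
        using iJ by (intro AE_PiM_component prob_space_exp_law AE_exp_law_nonneg)
      then show "AE x in ?J. (\<integral>\<^sup>+y. (\<Prod>j\<in>J - {i}. if x j < x i then 1 else 0) *
          ((\<Prod>j\<in>S. if x i < y j then 1 else 0) * g (\<Sum>j\<in>S. y j - x i)) \<partial>?S) =
          w x * (\<integral>\<^sup>+y. g (\<Sum>j\<in>S. y j) \<partial>?S)"
      proof eventually_elim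
        case (elim x)
        have "(\<integral>\<^sup>+y. (\<Prod>j\<in>J - {i}. if x j < x i then 1 else 0) *
            ((\<Prod>j\<in>S. if x i < y j then 1 else 0) * g (\<Sum>j\<in>S. y j - x i)) \<partial>?S) =
          (\<Prod>j\<in>J - {i}. if x j < x i then 1 else 0) *
            (\<integral>\<^sup>+y. (\<Prod>j\<in>S. if x i < y j then 1 else 0) * g (\<Sum>j\<in>S. y j - x i) \<partial>?S)"
          by (rule nn_integral_cmult) measurable
        also have "\<dots> = w x * (\<integral>\<^sup>+y. g (\<Sum>j\<in>S. y j) \<partial>?S)"
          unfolding exp_law_memoryless_PiM[OF fin(1) g elim] w_def by (simp add: mult_ac)
        finally show ?case .
      qed
    qed
    also have "\<dots> = (\<integral>\<^sup>+x. w x \<partial>?J) * (\<integral>\<^sup>+y. g (\<Sum>j\<in>S. y j) \<partial>?S)"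
      by (rule nn_integral_multc) measurable
    finally show ?thesis .
  qed
  have S: "emeasure ?S (space ?S) = 1"
    by (intro prob_space.emeasure_space_1 prob_space_PiM prob_space_exp_law)
  have "(\<integral>\<^sup>+x. w x \<partial>?J) = (\<integral>\<^sup>+y. evt y \<partial>PiM (J \<union> S) (\<lambda>_. exp_law))"
    using fold[of "\<lambda>_. 1"] S by simp
  then show ?thesis using fold[OF h] by simp
qed

text \<open>There are almost surely no ties, because each coordinate avoids any value fixed by the others.\<close>

lemma AE_PiM_exp_law_inj_on:
  assumes "finite N"
  shows "AE y in PiM N (\<lambda>_. exp_law). inj_on y N"
proof -
  have neq: "AE y in PiM N (\<lambda>_. exp_law). y i \<noteq> y j" if ij: "i \<in> N" "j \<in> N" "i \<noteq> j" for i j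
  proof -
    let ?N' = "N - {i}"
    have N: "N = insert i ?N'" using ij by auto
    have "(\<integral>\<^sup>+y. indicator {y\<in>space (PiM N (\<lambda>_. exp_law)). y i = y j} y \<partial>PiM N (\<lambda>_. exp_law)) =
        (\<integral>\<^sup>+y. (if y i = y j then 1 else 0) \<partial>PiM N (\<lambda>_. exp_law))"
      by (intro nn_integral_cong) (auto simp: indicator_def)
    also have "\<dots> = (\<integral>\<^sup>+y. (if y i = y j then 1 else 0) \<partial>PiM (insert i ?N') (\<lambda>_. exp_law))"
      using N by simp
    also have "\<dots> = (\<integral>\<^sup>+x. (\<integral>\<^sup>+y. (if y = x j then 1 else 0) \<partial>exp_law) \<partial>PiM ?N' (\<lambda>_. exp_law))"
      using assms ij by (subst exp_prod.product_nn_integral_insert) auto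
    also have "\<dots> = (\<integral>\<^sup>+x. 0 \<partial>PiM ?N' (\<lambda>_. exp_law))"
    proof (rule nn_integral_cong)
      fix x :: "'a \<Rightarrow> real"
      have "(\<integral>\<^sup>+y. (if y = x j then 1 else 0) \<partial>exp_law) = (\<integral>\<^sup>+y. 0 \<partial>exp_law)"
        using AE_exp_law_neq[of "x j"] by (intro nn_integral_cong_AE) auto
      then show "(\<integral>\<^sup>+y. (if y = x j then 1 else 0) \<partial>exp_law) = 0" by simp
    qed
    finally have "emeasure (PiM N (\<lambda>_. exp_law)) {y\<in>space (PiM N (\<lambda>_. exp_law)). y i = y j} = 0"
      using ij by simp
    then show ?thesis
      using ij by (subst AE_iff_measurable[OF _ refl]) auto
  qed
  have "AE y in PiM N (\<lambda>_. exp_law). \<forall>i\<in>N. \<forall>j\<in>N. i \<noteq> j \<longrightarrow> y i \<noteq> y j"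
    using assms neq by (auto intro!: AE_finite_allI AE_impI)
  then show ?thesis by eventually_elim (auto simp: inj_on_def)
qed

section \<open>Renyi's representation of the Hill statistic of exponential variables\<close>

text \<open>The indicator of the event that \<open>S\<close> is the set of indices of the largest values and that \<open>i\<close> is
  the index of the next one. As a product it separates into a factor over \<open>S\<close> and one over the other
  indices.\<close>

definition top_event :: "nat \<Rightarrow> nat \<Rightarrow> nat set \<Rightarrow> (nat \<Rightarrow> real) \<Rightarrow> ennreal" where
  "top_event n i S y =
     (\<Prod>j\<in>S. if y i < y j then 1 else 0) * (\<Prod>j\<in>{1..n} - S - {i}. if y j < y i then 1 else 0)"

lemma top_event_eq:
  assumes "finite S"
  shows "top_event n i S y =
    (if (\<forall>j\<in>S. y i < y j) \<and> (\<forall>j\<in>{1..n} - S - {i}. y j < y i) then 1 else 0)"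
proof -
  have "(\<Prod>j\<in>A. if P j then 1 else (0::ennreal)) = (if \<forall>j\<in>A. P j then 1 else 0)"
    if "finite A" for A :: "nat set" and P
    using that by (induction A) auto
  then show ?thesis using assms by (simp add: top_event_def)
qed

text \<open>The sample space splits, up to ties, into the events on which the top set and the threshold index
  are prescribed, and on each of them the Hill statistic is a plain sum of excesses.\<close>

lemma hill_decomposition:
  assumes inj: "inj_on y {1..n}" and k: "1 \<le> k" "k < n"
  shows "(h (real k * hill y n k) :: ennreal) =
    (\<Sum>(i, S)\<in>(SIGMA i:{1..n}. {S. S \<subseteq> {1..n} - {i} \<and> card S = k}).
       top_event n i S y * h (\<Sum>j\<in>S. y j - y i))"
proof -
  let ?Idx = "SIGMA i:{1..n}. {S. S \<subseteq> {1..n} - {i} \<and> card S = k}"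
  obtain i S where iS: "i \<in> {1..n}" "S \<subseteq> {1..n} - {i}" "card S = k" "y i = order_stat y n (n - k)"
    "S = {j\<in>{1..n}. order_stat y n (n - k) < y j}"
    and uniq: "\<And>i' S'. i' \<in> {1..n} \<Longrightarrow> S' \<subseteq> {1..n} - {i'} \<Longrightarrow> card S' = k \<Longrightarrow>
       (\<forall>j\<in>S'. y i' < y j) \<and> (\<forall>j\<in>{1..n} - S' - {i'}. y j < y i') \<longleftrightarrow> i' = i \<and> S' = S"
    using ex1_top_set_of_distinct_sample[OF inj k] by blast
  have fin: "finite ?Idx"
    by (intro finite_SigmaI) (auto intro: finite_subset[of _ "Pow {1..n}"])
  have "(\<Sum>(i, S)\<in>?Idx. top_event n i S y * h (\<Sum>j\<in>S. y j - y i)) =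
      (\<Sum>p\<in>?Idx. if p = (i, S) then h (\<Sum>j\<in>S. y j - y i) else 0)"
  proof (intro sum.cong refl)
    fix p assume p: "p \<in> ?Idx"
    obtain i' S' where [simp]: "p = (i', S')" by (cases p)
    have p': "i' \<in> {1..n}" "S' \<subseteq> {1..n} - {i'}" "card S' = k" using p by auto
    then have "finite S'" by (auto intro: finite_subset)
    then have "top_event n i' S' y = (if i' = i \<and> S' = S then 1 else 0)"
      using top_event_eq[of S' n i' y] uniq[OF p'] by presburger
    then show "(case p of (i, S) \<Rightarrow> top_event n i S y * h (\<Sum>j\<in>S. y j - y i)) =
        (if p = (i, S) then h (\<Sum>j\<in>S. y j - y i) else 0)"
      by simp
  qed
  also have "\<dots> = h (\<Sum>j\<in>S. y j - y i)"
    using fin iS by (subst sum.delta) auto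
  also have "(\<Sum>j\<in>S. y j - y i) = (\<Sum>j\<in>{1..n}. max (y j - order_stat y n (n - k)) 0)"
    unfolding iS(4)
    by (rule sum.mono_neutral_cong_left) (auto simp: iS(5) max_def)
  finally show ?thesis by (simp add: hill_eq_sum_excesses[OF k])
qed

text \<open>By the decomposition and the memoryless property, the law of the Hill statistic is the same on every
  event \<open>(i, S)\<close>, namely that of a sum of \<open>k\<close> independent exponential variables. Averaging over the
  events leaves this law, weighted by their total probability, which is \<open>1\<close>; the
  probabilities of the single events are never computed.\<close>

lemma (in prob_space) distr_hill_exponential:
  fixes E :: "nat \<Rightarrow> 'a \<Rightarrow> real"
  assumes indep: "indep_vars (\<lambda>_. borel) E {1..n}"
    and E: "\<And>i. i \<in> {1..n} \<Longrightarrow> distributed M lborel (E i) (exponential_density 1)"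
    and k: "1 \<le> k" "k < n"
  shows "distr M borel (\<lambda>\<omega>. real k * hill (\<lambda>i. E i \<omega>) n k) = distr M borel (\<lambda>\<omega>. \<Sum>i\<in>{1..k}. E i \<omega>)"
proof -
  let ?P = "\<lambda>S. PiM S (\<lambda>_. exp_law)"
  let ?Idx = "SIGMA i:{1..n}. {S. S \<subseteq> {1..n} - {i} \<and> card S = k}"
  have rv [measurable]: "E i \<in> borel_measurable M" if "i \<in> {1..n}" for i
    using distributed_measurable[OF E[OF that]] by simp
  have dE: "distr M borel (E i) = exp_law" if "i \<in> {1..n}" for i
    using distributed_distr_eq_density[OF E[OF that]] by (simp add: exp_law_def cong: distr_cong)
  have dS: "distr M (PiM S (\<lambda>_. borel)) (\<lambda>\<omega>. \<lambda>i\<in>S. E i \<omega>) = ?P S" if S: "S \<subseteq> {1..n}" "S \<noteq> {}" for S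
  proof -
    have "distr M (PiM S (\<lambda>_. borel)) (\<lambda>\<omega>. \<lambda>i\<in>S. E i \<omega>) = PiM S (\<lambda>i. distr M borel (E i))"
      using S rv indep_vars_subset[OF indep S(1)] by (intro indep_vars_iff_distr_eq_PiM'[THEN iffD1]) auto
    also have "\<dots> = ?P S" using S dE by (intro PiM_cong) auto
    finally show ?thesis .
  qed
  have transfer: "(\<integral>\<^sup>+y. f y \<partial>?P S) = (\<integral>\<^sup>+\<omega>. f (\<lambda>i\<in>S. E i \<omega>) \<partial>M)"
    if S: "S \<subseteq> {1..n}" "S \<noteq> {}" and f: "f \<in> borel_measurable (PiM S (\<lambda>_. borel))" for S f
  proof -
    have "(\<lambda>\<omega>. \<lambda>i\<in>S. E i \<omega>) \<in> M \<rightarrow>\<^sub>M PiM S (\<lambda>_. borel)"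
      using S rv by (intro measurable_restrict) auto
    then show ?thesis unfolding dS[OF S, symmetric] using f by (simp add: nn_integral_distr)
  qed
  \<comment> \<open>The sum over \<open>S\<close> has an Erlang law, which depends on \<open>S\<close> through its cardinality only.\<close>
  have sum_law: "(\<integral>\<^sup>+y. h (\<Sum>j\<in>S. y j) \<partial>?P S) = (\<integral>\<^sup>+\<omega>. h (\<Sum>j\<in>{1..k}. E j \<omega>) \<partial>M)"
    if S: "S \<subseteq> {1..n}" "card S = k" and [measurable]: "h \<in> borel_measurable borel" for S h
  proof -
    have erl: "(\<integral>\<^sup>+\<omega>. h (\<Sum>j\<in>A. E j \<omega>) \<partial>M) = (\<integral>\<^sup>+x. ennreal (erlang_density (k - 1) 1 x) * h x \<partial>lborel)"
      if A: "A \<subseteq> {1..n}" "card A = k" for A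
    proof -
      have "distributed M lborel (\<lambda>\<omega>. \<Sum>j\<in>A. E j \<omega>) (erlang_density (card A - 1) 1)"
        using A k E indep_vars_subset[OF indep A(1)]
        by (intro exponential_distributed_sum) (auto intro: finite_subset)
      then show ?thesis
        using A by (subst distributed_nn_integral[symmetric]) auto
    qed
    have "(\<integral>\<^sup>+y. h (\<Sum>j\<in>S. y j) \<partial>?P S) = (\<integral>\<^sup>+\<omega>. h (\<Sum>j\<in>S. E j \<omega>) \<partial>M)"
      using S k by (subst transfer) (auto intro!: nn_integral_cong sum.cong arg_cong[where f = h])
    then show ?thesis using erl[OF S] erl[of "{1..k}"] k by simp
  qed
  have key: "(\<integral>\<^sup>+y. h (real k * hill y n k) \<partial>?P {1..n}) =
      (\<Sum>(i, S)\<in>?Idx. (\<integral>\<^sup>+y. top_event n i S y \<partial>?P {1..n})) * (\<integral>\<^sup>+\<omega>. h (\<Sum>j\<in>{1..k}. E j \<omega>) \<partial>M)"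
    if h [measurable]: "h \<in> borel_measurable borel" for h :: "real \<Rightarrow> ennreal"
  proof -
    have meas: "(\<lambda>y. top_event n i S y * h (\<Sum>j\<in>S. y j - y i)) \<in> borel_measurable (?P {1..n})"
      if "i \<in> {1..n}" "S \<subseteq> {1..n}" for i S
    proof -
      have comp: "(\<lambda>y. y j) \<in> borel_measurable (?P {1..n})" if "j \<in> {1..n}" for j
        using that by measurable
      have less: "(\<lambda>y. if y j < y l then 1 else (0::ennreal)) \<in> borel_measurable (?P {1..n})"
        if "j \<in> {1..n}" "l \<in> {1..n}" for j l
        using comp[OF that(1), measurable] comp[OF that(2), measurable] by measurable
      have [measurable]: "(\<lambda>y. \<Sum>j\<in>S. y j - y i) \<in> borel_measurable (?P {1..n})"
        by (intro borel_measurable_sum borel_measurable_diff comp) (use that in auto)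
      have [measurable]: "top_event n i S \<in> borel_measurable (?P {1..n})"
        unfolding top_event_def
        by (intro borel_measurable_times_ennreal borel_measurable_prod_ennreal less) (use that in auto)
      show ?thesis by measurable
    qed
    have "(\<integral>\<^sup>+y. h (real k * hill y n k) \<partial>?P {1..n}) =
        (\<integral>\<^sup>+y. (\<Sum>(i, S)\<in>?Idx. top_event n i S y * h (\<Sum>j\<in>S. y j - y i)) \<partial>?P {1..n})"
      using AE_PiM_exp_law_inj_on[of "{1..n}"]
      by (intro nn_integral_cong_AE) (auto elim!: eventually_mono simp: hill_decomposition[OF _ k])
    also have "\<dots> = (\<Sum>(i, S)\<in>?Idx. (\<integral>\<^sup>+y. top_event n i S y * h (\<Sum>j\<in>S. y j - y i) \<partial>?P {1..n}))"
      unfolding case_prod_beta by (intro nn_integral_sum meas) auto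
    also have "\<dots> = (\<Sum>(i, S)\<in>?Idx. (\<integral>\<^sup>+y. top_event n i S y \<partial>?P {1..n}) * (\<integral>\<^sup>+\<omega>. h (\<Sum>j\<in>{1..k}. E j \<omega>) \<partial>M))"
    proof (intro sum.cong refl, clarify)
      fix i S assume i: "i \<in> {1..n}" and S: "S \<subseteq> {1..n} - {i}" "k = card S"
      have fin: "finite S" using S finite_subset by blast
      have un: "({1..n} - S) \<union> S = {1..n}" using S by auto
      have "(\<integral>\<^sup>+y. top_event n i S y * h (\<Sum>j\<in>S. y j - y i) \<partial>?P {1..n}) =
          (\<integral>\<^sup>+y. top_event n i S y \<partial>?P {1..n}) * (\<integral>\<^sup>+y. h (\<Sum>j\<in>S. y j) \<partial>?P S)"
        using excess_integral_factorizes[OF fin, of "{1..n} - S" i h, unfolded un] i S(1) h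
        unfolding top_event_def by blast
      also have "(\<integral>\<^sup>+y. h (\<Sum>j\<in>S. y j) \<partial>?P S) = (\<integral>\<^sup>+\<omega>. h (\<Sum>j\<in>{1..card S}. E j \<omega>) \<partial>M)"
        using sum_law[of S h] S by auto
      finally show "(\<integral>\<^sup>+y. top_event n i S y * h (\<Sum>j\<in>S. y j - y i) \<partial>?P {1..n}) =
          (\<integral>\<^sup>+y. top_event n i S y \<partial>?P {1..n}) * (\<integral>\<^sup>+\<omega>. h (\<Sum>j\<in>{1..card S}. E j \<omega>) \<partial>M)" .
    qed
    also have "\<dots> = (\<Sum>(i, S)\<in>?Idx. (\<integral>\<^sup>+y. top_event n i S y \<partial>?P {1..n})) * (\<integral>\<^sup>+\<omega>. h (\<Sum>j\<in>{1..k}. E j \<omega>) \<partial>M)"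
      by (simp add: sum_distrib_right case_prod_beta)
    finally show ?thesis .
  qed
  have "emeasure (?P {1..n}) (space (?P {1..n})) = 1"
    by (intro prob_space.emeasure_space_1 prob_space_PiM prob_space_exp_law)
  \<comment> \<open>The case \<open>h = 1\<close> says that the events exhaust the space.\<close>
  then have total: "(\<Sum>(i, S)\<in>?Idx. (\<integral>\<^sup>+y. top_event n i S y \<partial>?P {1..n})) = 1"
    using key[of "\<lambda>_. 1"] by (simp add: emeasure_space_1)
  have hillm: "(\<lambda>y. hill y n k) \<in> borel_measurable (PiM {1..n} (\<lambda>_. borel))"
    by (rule borel_measurable_hill[where X = "\<lambda>i y. y i"]) (use k in auto)
  have hillM [measurable]: "(\<lambda>\<omega>. hill (\<lambda>i. E i \<omega>) n k) \<in> borel_measurable M"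
    by (rule borel_measurable_hill) (use k rv in auto)
  have sumM: "(\<lambda>\<omega>. \<Sum>i\<in>{1..k}. E i \<omega>) \<in> borel_measurable M"
    by (intro borel_measurable_sum rv) (use k in auto)
  have hill_restrict: "hill (\<lambda>i\<in>{1..n}. y i) n k = hill y n k" for y
  proof -
    have "map (\<lambda>i\<in>{1..n}. y i) [1..<Suc n] = map y [1..<Suc n]" by (auto simp del: upt_Suc)
    then show ?thesis unfolding hill_def order_stat_def by (simp only:)
  qed
  show ?thesis
  proof (rule measure_eqI)
    fix B assume "B \<in> sets (distr M borel (\<lambda>\<omega>. real k * hill (\<lambda>i. E i \<omega>) n k))"
    then have B [measurable]: "B \<in> sets borel" by simp
    have "emeasure (distr M borel (\<lambda>\<omega>. real k * hill (\<lambda>i. E i \<omega>) n k)) B =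
        (\<integral>\<^sup>+\<omega>. indicator B (real k * hill (\<lambda>i. E i \<omega>) n k) \<partial>M)"
      by (subst nn_integral_distr[symmetric, of _ _ borel "indicator B"]) auto
    also have "\<dots> = (\<integral>\<^sup>+y. indicator B (real k * hill y n k) \<partial>?P {1..n})"
    proof -
      have "(\<lambda>y. indicator B (real k * hill y n k) :: ennreal) \<in> borel_measurable (PiM {1..n} (\<lambda>_. borel))"
        using hillm by measurable
      then show ?thesis using k by (subst transfer) (simp_all only: hill_restrict, auto)
    qed
    also have "\<dots> = (\<integral>\<^sup>+\<omega>. indicator B (\<Sum>j\<in>{1..k}. E j \<omega>) \<partial>M)"
    proof -
      have "(indicator B :: real \<Rightarrow> ennreal) \<in> borel_measurable borel" by measurable
      from key[OF this] show ?thesis unfolding total by simp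
    qed
    also have "\<dots> = emeasure (distr M borel (\<lambda>\<omega>. \<Sum>i\<in>{1..k}. E i \<omega>)) B"
      using sumM by (subst nn_integral_distr[symmetric, of _ _ borel "indicator B"]) auto
    finally show "emeasure (distr M borel (\<lambda>\<omega>. real k * hill (\<lambda>i. E i \<omega>) n k)) B =
      emeasure (distr M borel (\<lambda>\<omega>. \<Sum>i\<in>{1..k}. E i \<omega>)) B" .
  qed simp
qed

section \<open>The cumulative hazard function\<close>

text \<open>For \<open>x \<ge> 0\<close> this is \<open>- ln (1 - F x)\<close> with \<open>F\<close> the Pseudo-Lindley distribution function. On the
  negative half-line, where that expression vanishes, the linear continuation \<open>\<theta> * x\<close> is taken
  instead: then the function is strictly increasing and onto, and the estimates of its increments
  hold whatever the sign of the observations.\<close>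

definition cumulative_hazard :: "real \<Rightarrow> real \<Rightarrow> real \<Rightarrow> real" where
  "cumulative_hazard \<theta> \<beta> x = \<theta> * x - ln (1 + \<theta> * max x 0 / \<beta>)"

context
  fixes \<theta> \<beta> :: real
  assumes \<theta>: "\<theta> > 0" and \<beta>: "\<beta> > 1"
begin

text \<open>The hazard rate lies below \<open>\<theta>\<close> and approaches it from below at rate \<open>1 / x\<close>. The bounds
  express this through \<open>0 \<le> ln b - ln a \<le> (b - a) / a\<close>.\<close>

lemma cumulative_hazard_increment:
  assumes "x \<le> y"
  shows "cumulative_hazard \<theta> \<beta> y - cumulative_hazard \<theta> \<beta> x \<le> \<theta> * (y - x)"
    and "\<theta> * (1 - 1 / (\<beta> + \<theta> * max x 0)) * (y - x) \<le> cumulative_hazard \<theta> \<beta> y - cumulative_hazard \<theta> \<beta> x"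
proof -
  define a b where "a = \<beta> + \<theta> * max x 0" and "b = \<beta> + \<theta> * max y 0"
  have a: "0 < a" and ab: "a \<le> b" and b_a: "b - a \<le> \<theta> * (y - x)"
  proof -
    show "0 < a" using \<theta> \<beta> by (simp add: a_def add_pos_nonneg)
    show "a \<le> b" unfolding a_def b_def using \<theta> assms by (intro add_left_mono mult_left_mono) auto
    have "b - a = \<theta> * (max y 0 - max x 0)" by (simp add: a_def b_def algebra_simps)
    also have "\<dots> \<le> \<theta> * (y - x)" using \<theta> assms by (intro mult_left_mono) auto
    finally show "b - a \<le> \<theta> * (y - x)" .
  qed
  have ln_eq: "ln (1 + \<theta> * max z 0 / \<beta>) = ln (\<beta> + \<theta> * max z 0) - ln \<beta>" for z
  proof -
    have "1 + \<theta> * max z 0 / \<beta> = (\<beta> + \<theta> * max z 0) / \<beta>" using \<beta> by (simp add: field_simps)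
    moreover have "0 < \<beta> + \<theta> * max z 0" using \<theta> \<beta> by (simp add: add_pos_nonneg)
    ultimately show ?thesis using \<beta> by (simp add: ln_div)
  qed
  have eq: "cumulative_hazard \<theta> \<beta> y - cumulative_hazard \<theta> \<beta> x = \<theta> * (y - x) - (ln b - ln a)"
    unfolding cumulative_hazard_def ln_eq a_def b_def by (simp add: algebra_simps)
  show "cumulative_hazard \<theta> \<beta> y - cumulative_hazard \<theta> \<beta> x \<le> \<theta> * (y - x)"
    unfolding eq using a ab by simp
  have "ln b - ln a \<le> (b - a) / a"
    using a ab by (intro ln_diff_le) auto
  also have "\<dots> \<le> \<theta> * (y - x) / a" using b_a a by (intro divide_right_mono) auto
  finally show "\<theta> * (1 - 1 / (\<beta> + \<theta> * max x 0)) * (y - x) \<le> cumulative_hazard \<theta> \<beta> y - cumulative_hazard \<theta> \<beta> x"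
    unfolding eq a_def[symmetric] by (simp add: algebra_simps)
qed

lemma cumulative_hazard_strict_mono: "strict_mono (cumulative_hazard \<theta> \<beta>)"
proof (rule strict_monoI)
  fix x y :: real assume xy: "x < y"
  have "\<beta> \<le> \<beta> + \<theta> * max x 0" using \<theta> by simp
  then have "0 < 1 - 1 / (\<beta> + \<theta> * max x 0)" using \<beta> by (simp add: field_simps)
  then have "0 < \<theta> * (1 - 1 / (\<beta> + \<theta> * max x 0)) * (y - x)" using \<theta> xy by simp
  also have "\<dots> \<le> cumulative_hazard \<theta> \<beta> y - cumulative_hazard \<theta> \<beta> x"
    using xy by (intro cumulative_hazard_increment) simp
  finally show "cumulative_hazard \<theta> \<beta> x < cumulative_hazard \<theta> \<beta> y" by simp
qed

lemma cumulative_hazard_le: "cumulative_hazard \<theta> \<beta> x \<le> \<theta> * x"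
  using \<theta> \<beta> by (simp add: cumulative_hazard_def)

lemma isCont_cumulative_hazard: "isCont (cumulative_hazard \<theta> \<beta>) x"
proof -
  have "1 + \<theta> * max x 0 / \<beta> > 0" using \<theta> \<beta> by (intro add_pos_nonneg) auto
  then show ?thesis unfolding cumulative_hazard_def[abs_def]
    using \<beta> by (intro continuous_intros) auto
qed

text \<open>Since the hazard rate is bounded away from \<open>0\<close>, the function grows at least linearly to the right;
  to the left it stays below the line of slope \<open>\<theta>\<close>.\<close>

lemma cumulative_hazard_surj:
  obtains q where "cumulative_hazard \<theta> \<beta> q = t"
proof -
  define c where "c = \<theta> * (1 - 1 / \<beta>)"
  have c: "c > 0" using \<theta> \<beta> by (simp add: c_def)
  define y where "y = max (t / c) (max (t / \<theta>) 0)"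
  have "cumulative_hazard \<theta> \<beta> (t / \<theta>) \<le> t"
    using cumulative_hazard_le[of "t / \<theta>"] \<theta> by simp
  moreover have "t \<le> cumulative_hazard \<theta> \<beta> y"
  proof -
    have "t \<le> c * y" using c by (simp add: y_def field_simps max_def)
    also have "\<dots> \<le> cumulative_hazard \<theta> \<beta> y"
      using cumulative_hazard_increment(2)[of 0 y] by (simp add: y_def c_def cumulative_hazard_def)
    finally show ?thesis .
  qed
  ultimately have "\<exists>q. t / \<theta> \<le> q \<and> q \<le> y \<and> cumulative_hazard \<theta> \<beta> q = t"
    by (intro IVT) (auto simp: y_def isCont_cumulative_hazard)
  then show ?thesis using that by blast
qed

text \<open>This is the probability integral transform: a random variable with continuous distribution
  function is turned into an exponential one by its cumulative hazard.\<close>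

lemma distributed_cumulative_hazard:
  assumes "prob_space M" and X [measurable]: "X \<in> borel_measurable M"
    and cdf: "cdf (distr M borel X) = cdf (pseudo_lindley \<theta> \<beta>)"
  shows "distributed M lborel (\<lambda>\<omega>. cumulative_hazard \<theta> \<beta> (X \<omega>)) (exponential_density 1)"
proof -
  interpret prob_space M by fact
  have [measurable]: "cumulative_hazard \<theta> \<beta> \<in> borel_measurable borel"
    unfolding cumulative_hazard_def[abs_def] by measurable
  have "prob {\<omega>\<in>space M. cumulative_hazard \<theta> \<beta> (X \<omega>) \<le> t} = 1 - exp (- t)" if t: "0 \<le> t" for t
  proof -
    obtain q where q: "cumulative_hazard \<theta> \<beta> q = t" by (rule cumulative_hazard_surj)
    have "0 \<le> \<theta> * q" using cumulative_hazard_le[of q] q t by linarith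
    then have q0: "0 \<le> q" using \<theta> by (simp add: zero_le_mult_iff)
    have "prob {\<omega>\<in>space M. cumulative_hazard \<theta> \<beta> (X \<omega>) \<le> t} = prob (X -` {..q} \<inter> space M)"
      unfolding q[symmetric] strict_mono_less_eq[OF cumulative_hazard_strict_mono]
      by (rule arg_cong[where f = prob]) auto
    also have "\<dots> = cdf (distr M borel X) q"
      by (simp add: cdf_def measure_distr)
    also have "\<dots> = 1 - (\<beta> + \<theta> * q) * exp (- \<theta> * q) / \<beta>"
      unfolding cdf cdf_pseudo_lindley[OF \<theta> \<beta>] using q0 by simp
    also have "(\<beta> + \<theta> * q) * exp (- \<theta> * q) / \<beta> = exp (- t)"
    proof -
      have "exp (- t) = exp (- \<theta> * q) * exp (ln (1 + \<theta> * q / \<beta>))"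
        unfolding q[symmetric] exp_add[symmetric] using q0 by (simp add: cumulative_hazard_def)
      also have "exp (ln (1 + \<theta> * q / \<beta>)) = 1 + \<theta> * q / \<beta>"
        using \<theta> \<beta> q0 by (intro exp_ln add_pos_nonneg) auto
      finally show ?thesis using \<beta> by (simp add: field_simps)
    qed
    finally show ?thesis .
  qed
  then show ?thesis by (subst exponential_distributed_iff) auto
qed

text \<open>The lower bound on increments, stated in terms of the hazard level \<open>v\<close> of the left endpoint. The
  relative error \<open>1 / v\<close> is the bias that the Hill estimator inherits from the linear factor in the
  tail of \<open>F\<close>.\<close>

lemma spacing_le_hazard_spacing:
  assumes v: "0 < v" "v \<le> cumulative_hazard \<theta> \<beta> x" and xy: "x \<le> y"
  shows "\<theta> * (y - x) \<le> (1 + 1 / v) * (cumulative_hazard \<theta> \<beta> y - cumulative_hazard \<theta> \<beta> x)"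
proof -
  define a where "a = \<beta> + \<theta> * max x 0"
  have "v \<le> \<theta> * x" using v cumulative_hazard_le[of x] by linarith
  also have "\<dots> \<le> \<theta> * max x 0" using \<theta> by (intro mult_left_mono) auto
  finally have a: "1 + v < a" using \<beta> by (simp add: a_def)
  have "1 \<le> (1 + 1 / v) * (1 - 1 / a)"
  proof -
    have "1 / a \<le> 1 / (1 + v)" using a v by (intro divide_left_mono) auto
    then have "(1 + 1 / v) * (1 - 1 / (1 + v)) \<le> (1 + 1 / v) * (1 - 1 / a)"
      using v by (intro mult_left_mono) auto
    moreover have "(1 + 1 / v) * (1 - 1 / (1 + v)) = 1"
    proof -
      have "v + v * v > 0" using v by (intro add_pos_pos mult_pos_pos)
      then show ?thesis using v by (simp add: field_simps)
    qed
    ultimately show ?thesis by simp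
  qed
  then have "1 * (\<theta> * (y - x)) \<le> (1 + 1 / v) * (1 - 1 / a) * (\<theta> * (y - x))"
    using \<theta> xy by (intro mult_right_mono) auto
  also have "\<dots> = (1 + 1 / v) * (\<theta> * (1 - 1 / a) * (y - x))" by (simp add: mult_ac)
  also have "\<dots> \<le> (1 + 1 / v) * (cumulative_hazard \<theta> \<beta> y - cumulative_hazard \<theta> \<beta> x)"
    using cumulative_hazard_increment(2)[OF xy] v unfolding a_def by (intro mult_left_mono) auto
  finally show ?thesis by simp
qed

lemma hill_cumulative_hazard_le:
  assumes "k < n"
  shows "hill (\<lambda>i. cumulative_hazard \<theta> \<beta> (x i)) n k \<le> \<theta> * hill x n k"
proof -
  have mono: "mono (cumulative_hazard \<theta> \<beta>)"
    by (rule strict_mono_mono[OF cumulative_hazard_strict_mono])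
  have "(\<Sum>j=1..k. real j * (order_stat (\<lambda>i. cumulative_hazard \<theta> \<beta> (x i)) n (n - j + 1) -
          order_stat (\<lambda>i. cumulative_hazard \<theta> \<beta> (x i)) n (n - j))) \<le>
      (\<Sum>j=1..k. real j * (\<theta> * (order_stat x n (n - j + 1) - order_stat x n (n - j))))"
    using assms
    by (intro sum_mono mult_left_mono)
      (auto simp: order_stat_mono_transform[OF mono] intro!: cumulative_hazard_increment(1) order_stat_mono)
  also have "\<dots> = \<theta> * (\<Sum>j=1..k. real j * (order_stat x n (n - j + 1) - order_stat x n (n - j)))"
    by (simp add: sum_distrib_left mult_ac)
  finally show ?thesis
    unfolding hill_def by (simp add: divide_right_mono)
qed

lemma hill_le_hill_cumulative_hazard:
  assumes "k < n" and v: "0 < v" "v \<le> order_stat (\<lambda>i. cumulative_hazard \<theta> \<beta> (x i)) n (n - k)"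
  shows "\<theta> * hill x n k \<le> (1 + 1 / v) * hill (\<lambda>i. cumulative_hazard \<theta> \<beta> (x i)) n k"
proof -
  have mono: "mono (cumulative_hazard \<theta> \<beta>)"
    by (rule strict_mono_mono[OF cumulative_hazard_strict_mono])
  have "\<theta> * (\<Sum>j=1..k. real j * (order_stat x n (n - j + 1) - order_stat x n (n - j))) =
      (\<Sum>j=1..k. real j * (\<theta> * (order_stat x n (n - j + 1) - order_stat x n (n - j))))"
    by (simp add: sum_distrib_left mult_ac)
  also have "\<dots> \<le> (\<Sum>j=1..k. real j * ((1 + 1 / v) * (order_stat (\<lambda>i. cumulative_hazard \<theta> \<beta> (x i)) n (n - j + 1) -
          order_stat (\<lambda>i. cumulative_hazard \<theta> \<beta> (x i)) n (n - j))))"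
  proof (intro sum_mono mult_left_mono)
    fix j assume j: "j \<in> {1..k}"
    have "v \<le> cumulative_hazard \<theta> \<beta> (order_stat x n (n - k))"
      using v assms by (simp add: order_stat_mono_transform[OF mono])
    also have "\<dots> \<le> cumulative_hazard \<theta> \<beta> (order_stat x n (n - j))"
      using assms j by (intro monoD[OF mono] order_stat_mono) auto
    finally have "\<theta> * (order_stat x n (n - j + 1) - order_stat x n (n - j)) \<le>
        (1 + 1 / v) * (cumulative_hazard \<theta> \<beta> (order_stat x n (n - j + 1)) -
          cumulative_hazard \<theta> \<beta> (order_stat x n (n - j)))"
      using assms j by (intro spacing_le_hazard_spacing v order_stat_mono) auto
    then show "\<theta> * (order_stat x n (n - j + 1) - order_stat x n (n - j)) \<le>
        (1 + 1 / v) * (order_stat (\<lambda>i. cumulative_hazard \<theta> \<beta> (x i)) n (n - j + 1) -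
          order_stat (\<lambda>i. cumulative_hazard \<theta> \<beta> (x i)) n (n - j))"
      using assms j order_stat_mono_transform[OF mono, of "n - j" n x]
        order_stat_mono_transform[OF mono, of "n - j + 1" n x] by auto
  qed simp
  also have "\<dots> = (1 + 1 / v) * (\<Sum>j=1..k. real j * (order_stat (\<lambda>i. cumulative_hazard \<theta> \<beta> (x i)) n (n - j + 1) -
          order_stat (\<lambda>i. cumulative_hazard \<theta> \<beta> (x i)) n (n - j)))"
    by (simp add: sum_distrib_left mult_ac)
  finally show ?thesis
    unfolding hill_def using divide_right_mono by fastforce
qed

end

text \<open>The event means that at most \<open>k\<close> of the variables exceed \<open>t\<close>, a lower tail event of a
  binomial count \<open>N\<close>. The estimate is the exponential Markov inequality for \<open>2 powr (- N)\<close>, whose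
  expectation factorizes.\<close>

lemma (in prob_space) prob_order_stat_exponential_le:
  fixes E :: "nat \<Rightarrow> 'a \<Rightarrow> real"
  assumes indep: "indep_vars (\<lambda>_. borel) E {1..n}"
    and E: "\<And>i. i \<in> {1..n} \<Longrightarrow> distributed M lborel (E i) (exponential_density 1)"
    and k: "k < n" and t: "0 \<le> t"
  shows "prob {\<omega>\<in>space M. order_stat (\<lambda>i. E i \<omega>) n (n - k) \<le> t} \<le> 2 ^ k * (1 - exp (- t) / 2) ^ n"
proof -
  \<comment> \<open>One factor of \<open>2 powr (- N)\<close>.\<close>
  define w where "w = (\<lambda>x::real. if t < x then 1 / 2 else (1::real))"
  have w [measurable]: "w \<in> borel_measurable borel" unfolding w_def by measurable
  have rv [measurable]: "E i \<in> borel_measurable M" if "i \<in> {1..n}" for i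
    using distributed_measurable[OF E[OF that]] by simp
  have [measurable]: "(\<lambda>\<omega>. order_stat (\<lambda>i. E i \<omega>) n (n - k)) \<in> borel_measurable M"
    by (rule borel_measurable_order_stat) (use k rv in auto)
  have ind: "indep_vars (\<lambda>_. borel) (\<lambda>i \<omega>. w (E i \<omega>)) {1..n}"
    by (rule indep_vars_compose2[OF indep]) simp
  have int: "integrable M (\<lambda>\<omega>. w (E i \<omega>))" if "i \<in> {1..n}" for i
    using rv[OF that] by (intro integrable_const_bound[where B = 1]) (auto simp: w_def)
  have mean: "expectation (\<lambda>\<omega>. w (E i \<omega>)) = 1 - exp (- t) / 2" if i: "i \<in> {1..n}" for i
  proof -
    note rv[OF i, measurable]
    have "expectation (\<lambda>\<omega>. w (E i \<omega>)) = expectation (\<lambda>\<omega>. 1 - indicator {\<omega>\<in>space M. t < E i \<omega>} \<omega> / 2)"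
      by (intro Bochner_Integration.integral_cong) (auto simp: w_def indicator_def)
    also have "\<dots> = 1 - prob {\<omega>\<in>space M. t < E i \<omega>} / 2"
    proof -
      have "integrable M (indicator {\<omega>\<in>space M. t < E i \<omega>} :: _ \<Rightarrow> real)"
        by (intro integrable_real_indicator) (auto simp: less_top[symmetric])
      then show ?thesis
        by (subst Bochner_Integration.integral_diff) (auto simp: prob_space)
    qed
    also have "prob {\<omega>\<in>space M. t < E i \<omega>} = exp (- t)"
      using exponential_distributedD_gt[OF E[OF i] t] by simp
    finally show ?thesis .
  qed
  have "indicator {\<omega>\<in>space M. order_stat (\<lambda>i. E i \<omega>) n (n - k) \<le> t} \<omega> \<le> 2 ^ k * (\<Prod>i\<in>{1..n}. w (E i \<omega>))" for \<omega>
  proof (cases "order_stat (\<lambda>i. E i \<omega>) n (n - k) \<le> t")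
    case True
    let ?U = "{i\<in>{1..n}. t < E i \<omega>}"
    have "n - k \<le> card {i\<in>{1..n}. E i \<omega> \<le> t}"
      using True k by (subst (asm) order_stat_le_iff) auto
    also have "{i\<in>{1..n}. E i \<omega> \<le> t} = {1..n} - ?U" by auto
    also have "card \<dots> = n - card ?U" by (subst card_Diff_subset) auto
    finally have "card ?U \<le> k" using k by linarith
    then have "(1::real) \<le> 2 ^ k * (1 / 2) ^ card ?U"
      using power_increasing[of "card ?U" k "2::real"] by (simp add: power_divide field_simps)
    also have "(1 / 2) ^ card ?U = (\<Prod>i\<in>{1..n}. w (E i \<omega>))"
      unfolding w_def by (subst prod.If_cases) (auto simp: Int_def)
    finally show ?thesis by (simp add: indicator_def)
  next
    case False
    have "0 \<le> (\<Prod>i\<in>{1..n}. w (E i \<omega>))" by (intro prod_nonneg) (auto simp: w_def)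
    with False show ?thesis by simp
  qed
  then have "expectation (indicator {\<omega>\<in>space M. order_stat (\<lambda>i. E i \<omega>) n (n - k) \<le> t}) \<le>
      expectation (\<lambda>\<omega>. 2 ^ k * (\<Prod>i\<in>{1..n}. w (E i \<omega>)))"
    using indep_vars_integrable[OF _ ind int] by (intro integral_mono) 
      (auto intro!: integrable_mult_right integrable_real_indicator simp: less_top[symmetric])
  also have "\<dots> = 2 ^ k * (\<Prod>i\<in>{1..n}. expectation (\<lambda>\<omega>. w (E i \<omega>)))"
    using indep_vars_lebesgue_integral[OF _ ind int] by simp
  also have "\<dots> = 2 ^ k * (1 - exp (- t) / 2) ^ n" by (simp add: mean)
  finally show ?thesis by simp
qed

section \<open>Asymptotics of the exponential sample\<close>

text \<open>By the equality of laws, the distribution function of the normalized Hill statistic at \<open>n\<close>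
  coincides with that of the \<open>k n\<close>-th normalized partial sum of one fixed sequence, so the classical
  central limit theorem along the subsequence \<open>k\<close> applies.\<close>

lemma (in prob_space) CLT_hill_exponential:
  fixes E :: "nat \<Rightarrow> 'a \<Rightarrow> real" and k :: "nat \<Rightarrow> nat"
  assumes indep: "indep_vars (\<lambda>_. borel) E {1..}"
    and E: "\<And>i. i \<ge> 1 \<Longrightarrow> distributed M lborel (E i) (exponential_density 1)"
    and k: "\<And>n. n \<ge> 2 \<Longrightarrow> 1 \<le> k n \<and> k n < n"
    and lim: "filterlim k at_top sequentially"
  shows "(\<lambda>n. prob {\<omega>\<in>space M. sqrt (real (k n)) * (hill (\<lambda>i. E i \<omega>) n (k n) - 1) \<le> x})
    \<longlonglongrightarrow> cdf std_normal_distribution x"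
proof -
  have rv [measurable]: "E i \<in> borel_measurable M" if "i \<ge> 1" for i
    using distributed_measurable[OF E[OF that]] by simp
  have rvS [measurable]: "E (Suc i) \<in> borel_measurable M" for i by (rule rv) simp
  have dist: "distr M borel (E (Suc i)) = exp_law" for i
    using distributed_distr_eq_density[OF E, of "Suc i"] by (simp add: exp_law_def cong: distr_cong)
  have "indep_vars (\<lambda>_. borel) (\<lambda>i. E (Suc i)) UNIV"
  proof -
    \<comment> \<open>The shift to index \<open>0\<close> is obtained by restricting to the disjoint blocks \<open>{Suc i}\<close>.\<close>
    have "indep_vars (\<lambda>i. PiM {Suc i} (\<lambda>_. borel)) (\<lambda>i \<omega>. \<lambda>j\<in>{Suc i}. E j \<omega>) UNIV"
      by (rule indep_vars_restrict[OF indep]) (auto simp: disjoint_family_on_def)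
    then have "indep_vars (\<lambda>_. borel) (\<lambda>i \<omega>. (\<lambda>j\<in>{Suc i}. E j \<omega>) (Suc i)) UNIV"
      by (rule indep_vars_compose2) measurable
    then show ?thesis by simp
  qed
  then have "weak_conv_m (\<lambda>m. distr M borel (\<lambda>\<omega>. (\<Sum>i<m. E (Suc i) \<omega> - 1) / sqrt (real m * 1\<^sup>2))) std_normal_distribution"
  proof (rule central_limit_theorem)
    fix i
    show "expectation (E (Suc i)) = 1"
      using exponential_distributed_expectation[OF _ E, of "Suc i"] by simp
    show "variance (E (Suc i)) = 1\<^sup>2"
      using exponential_distributed_variance[OF _ E, of "Suc i"] by simp
    show "integrable M (\<lambda>\<omega>. (E (Suc i) \<omega>)\<^sup>2)"
      by (rule erlang_ith_moment_integrable[OF _ E]) auto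
    show "distr M borel (E (Suc i)) = exp_law" by (rule dist)
  qed simp
  moreover have "isCont (cdf std_normal_distribution) x"
  proof -
    interpret N: real_distribution std_normal_distribution by (rule real_dist_normal_dist)
    have "AE y in lborel. ennreal (std_normal_density y) * indicator {x} y = 0"
      using AE_lborel_singleton[of x] by eventually_elim simp
    then have "(\<integral>\<^sup>+y. ennreal (std_normal_density y) * indicator {x} y \<partial>lborel) = (\<integral>\<^sup>+(y::real). 0 \<partial>lborel)"
      by (rule nn_integral_cong_AE)
    then show ?thesis
      unfolding N.isCont_cdf by (simp add: measure_def emeasure_density)
  qed
  ultimately have "(\<lambda>m. cdf (distr M borel (\<lambda>\<omega>. (\<Sum>i<m. E (Suc i) \<omega> - 1) / sqrt (real m * 1\<^sup>2))) x)
      \<longlonglongrightarrow> cdf std_normal_distribution x"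
    unfolding weak_conv_m_def weak_conv_def by blast
  from filterlim_compose[OF this lim]
  show ?thesis
  proof (rule Lim_transform_eventually)
    show "\<forall>\<^sub>F n in sequentially. cdf (distr M borel (\<lambda>\<omega>. (\<Sum>i<k n. E (Suc i) \<omega> - 1) / sqrt (real (k n) * 1\<^sup>2))) x =
      prob {\<omega>\<in>space M. sqrt (real (k n)) * (hill (\<lambda>i. E i \<omega>) n (k n) - 1) \<le> x}"
      using eventually_ge_at_top[of 2]
    proof eventually_elim
      case (elim n)
      define c where "c = real (k n) + sqrt (real (k n)) * x"
      have kn: "1 \<le> k n" "k n < n" using k[OF elim] by auto
      have hillM: "(\<lambda>\<omega>. real (k n) * hill (\<lambda>i. E i \<omega>) n (k n)) \<in> borel_measurable M"
        using borel_measurable_hill[of n E M "k n"] kn rv by simp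
      have sumM: "(\<lambda>\<omega>. \<Sum>i\<in>{1..k n}. E i \<omega>) \<in> borel_measurable M"
        by (intro borel_measurable_sum rv) auto
      have sum_eq: "(\<Sum>i<k n. E (Suc i) \<omega> - 1) = (\<Sum>i\<in>{1..k n}. E i \<omega>) - real (k n)" for \<omega>
        by (simp add: sum_subtractf sum.atLeast1_atMost_eq)
      have le_iff: "(s - real (k n)) / sqrt (real (k n)) \<le> x \<longleftrightarrow> s \<le> c" for s
        using kn by (simp add: c_def field_simps)
      have le_iff': "sqrt (real (k n)) * (h - 1) \<le> x \<longleftrightarrow> real (k n) * h \<le> c" for h
      proof -
        have "sqrt (real (k n)) * (h - 1) = (real (k n) * h - real (k n)) / sqrt (real (k n))"
          using kn by (simp add: field_simps)
        then show ?thesis using le_iff[of "real (k n) * h"] by simp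
      qed
      have "cdf (distr M borel (\<lambda>\<omega>. (\<Sum>i<k n. E (Suc i) \<omega> - 1) / sqrt (real (k n) * 1\<^sup>2))) x =
          prob {\<omega>\<in>space M. (\<Sum>i\<in>{1..k n}. E i \<omega>) \<le> c}"
        unfolding cdf_def
        by (subst measure_distr)
          (auto simp: sum_eq le_iff simp del: of_nat_Suc intro!: arg_cong[where f = prob])
      also have "\<dots> = measure (distr M borel (\<lambda>\<omega>. \<Sum>i\<in>{1..k n}. E i \<omega>)) {..c}"
        using sumM by (subst measure_distr) (auto intro!: arg_cong[where f = prob])
      also have "\<dots> = measure (distr M borel (\<lambda>\<omega>. real (k n) * hill (\<lambda>i. E i \<omega>) n (k n))) {..c}"
        using E kn indep_vars_subset[OF indep, of "{1..n}"] by (subst distr_hill_exponential) auto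
      also have "\<dots> = prob {\<omega>\<in>space M. real (k n) * hill (\<lambda>i. E i \<omega>) n (k n) \<le> c}"
        using hillM by (subst measure_distr) (auto intro!: arg_cong[where f = prob])
      finally show ?case unfolding le_iff' .
    qed
  qed
qed

lemma cdf_normal_scale:
  assumes "\<gamma> > 0"
  shows "cdf (density lborel (\<lambda>x. ennreal (normal_density 0 \<gamma> x))) x = cdf std_normal_distribution (x / \<gamma>)"
proof -
  let ?N = "density lborel (\<lambda>x. ennreal (normal_density 0 \<gamma> x))"
  interpret N: prob_space ?N using assms by (rule prob_space_normal_density)
  have "distributed ?N lborel (\<lambda>x. x) (\<lambda>x. ennreal (normal_density 0 \<gamma> x))"
    unfolding distributed_def by (auto simp: distr_id2 intro!: normal_density_nonneg)
  then have "distributed ?N lborel (\<lambda>x. (x - 0) / \<gamma>) std_normal_density"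
    using N.normal_standard_normal_convert[OF assms, of "\<lambda>x. x" 0] by simp
  then have "std_normal_distribution = distr ?N lborel (\<lambda>x. x / \<gamma>)"
    using distributed_distr_eq_density[of ?N lborel "\<lambda>x. x / \<gamma>"] by simp
  then have "cdf std_normal_distribution (x / \<gamma>) = measure (distr ?N lborel (\<lambda>x. x / \<gamma>)) {..x / \<gamma>}"
    by (simp add: cdf_def)
  also have "\<dots> = measure ?N {..x}"
    using assms by (subst measure_distr) (auto intro!: arg_cong[where f = "measure ?N"] simp: divide_le_cancel)
  finally show ?thesis by (simp add: cdf_def)
qed

text \<open>A form of Slutsky's theorem adapted to one-sided comparison: \<open>G\<close> are the distribution functions
  of a convergent sequence, \<open>F\<close> those of a perturbation that only moves mass to the right, by more
  than \<open>\<epsilon>\<close> with probability at most \<open>p n\<close>.\<close>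

lemma squeeze_shifted_cdfs:
  fixes F :: "nat \<Rightarrow> real"
  assumes G: "\<And>y. (\<lambda>n. G n y) \<longlonglongrightarrow> \<Phi> y" and p: "p \<longlonglongrightarrow> 0" and cont: "isCont \<Phi> (x::real)"
    and upper: "\<forall>\<^sub>F n in sequentially. F n \<le> G n x"
    and lower: "\<And>\<epsilon>. \<epsilon> > 0 \<Longrightarrow> \<forall>\<^sub>F n in sequentially. G n (x - \<epsilon>) - p n \<le> F n"
  shows "F \<longlonglongrightarrow> (\<Phi> x :: real)"
proof (rule order_tendstoI)
  fix a assume "\<Phi> x < a"
  from order_tendstoD(2)[OF G this] upper show "\<forall>\<^sub>F n in sequentially. F n < a"
    by eventually_elim simp
next
  fix a assume a: "a < \<Phi> x"
  have "\<forall>\<^sub>F y in at x. a < \<Phi> y"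
    using cont a unfolding isCont_def by (rule order_tendstoD)
  then obtain d where d: "d > 0" "\<And>y. y \<noteq> x \<Longrightarrow> dist y x < d \<Longrightarrow> a < \<Phi> y"
    unfolding eventually_at by auto
  have less: "a < \<Phi> (x - d / 2)" using d by (intro d(2)) (auto simp: dist_real_def)
  have "(\<lambda>n. G n (x - d / 2) - p n) \<longlonglongrightarrow> \<Phi> (x - d / 2) - 0"
    by (intro tendsto_diff G p)
  from order_tendstoD(1)[OF this, of a] less lower[of "d / 2"] d(1)
  show "\<forall>\<^sub>F n in sequentially. a < F n"
    by (auto elim: eventually_elim2)
qed

text \<open>The two consequences of the growth condition on \<open>k\<close> that enter the proof: the bias, of order
  \<open>1 / ln n\<close>, is negligible at the scale \<open>1 / sqrt (k n)\<close>, and \<open>k n\<close> is much smaller than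
  \<open>sqrt n\<close>.\<close>

lemma intermediate_growth:
  fixes k :: "nat \<Rightarrow> nat"
  assumes k: "\<And>n. n \<ge> 2 \<Longrightarrow> 1 \<le> k n"
    and lim: "(\<lambda>n. real (k n) powr (3 / 4) / ln (real n)) \<longlonglongrightarrow> 0"
  shows "(\<lambda>n. sqrt (real (k n)) / ln (real n)) \<longlonglongrightarrow> 0"
    and "\<forall>\<^sub>F n in sequentially. real (k n) \<le> ln (real n) ^ 2"
proof -
  show "(\<lambda>n. sqrt (real (k n)) / ln (real n)) \<longlonglongrightarrow> 0"
  proof (rule tendsto_sandwich[OF _ _ tendsto_const lim])
    show "\<forall>\<^sub>F n in sequentially. 0 \<le> sqrt (real (k n)) / ln (real n)"
      using eventually_ge_at_top[of 2] by eventually_elim simp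
    show "\<forall>\<^sub>F n in sequentially. sqrt (real (k n)) / ln (real n) \<le> real (k n) powr (3 / 4) / ln (real n)"
      using eventually_ge_at_top[of 2]
    proof eventually_elim
      case (elim n)
      have "real (k n) powr (1 / 2) \<le> real (k n) powr (3 / 4)"
        using k[OF elim] by (intro powr_mono) auto
      then show ?case using elim by (auto simp: powr_half_sqrt intro!: divide_right_mono)
    qed
  qed
  have large: "\<forall>\<^sub>F n in sequentially. 1 \<le> ln (real n)" by real_asymp
  have small: "\<forall>\<^sub>F n in sequentially. real (k n) powr (3 / 4) / ln (real n) < 1"
    using order_tendstoD(2)[OF lim, of 1] by simp
  show "\<forall>\<^sub>F n in sequentially. real (k n) \<le> ln (real n) ^ 2"
    using large small eventually_ge_at_top[of 2]
  proof eventually_elim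
    case (elim n)
    have "real (k n) = (real (k n) powr (3 / 4)) powr (4 / 3)" using k[OF elim(3)] by (simp add: powr_powr)
    also have "\<dots> \<le> ln (real n) powr (4 / 3)"
      using elim by (intro powr_mono2) (auto simp: field_simps)
    also have "\<dots> \<le> ln (real n) powr 2" using elim by (intro powr_mono) auto
    finally show ?case using elim by (simp add: powr_numeral)
  qed
qed

text \<open>The level \<open>ln n / 2\<close> is exceeded by about \<open>sqrt n\<close> of the \<open>n\<close> variables, and this is far more than
  \<open>k n\<close>; the threshold of the Hill statistic therefore lies above that level.\<close>

lemma (in prob_space) order_stat_exponential_at_log_scale:
  fixes E :: "nat \<Rightarrow> 'a \<Rightarrow> real" and k :: "nat \<Rightarrow> nat"
  assumes indep: "indep_vars (\<lambda>_. borel) E {1..}"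
    and E: "\<And>i. i \<ge> 1 \<Longrightarrow> distributed M lborel (E i) (exponential_density 1)"
    and k: "\<And>n. n \<ge> 2 \<Longrightarrow> 1 \<le> k n \<and> k n < n"
    and small: "\<forall>\<^sub>F n in sequentially. real (k n) \<le> ln (real n) ^ 2"
  shows "(\<lambda>n. prob {\<omega>\<in>space M. order_stat (\<lambda>i. E i \<omega>) n (n - k n) \<le> ln (real n) / 2}) \<longlonglongrightarrow> 0"
proof (rule tendsto_sandwich[OF _ _ tendsto_const])
  show "(\<lambda>n. exp (ln (real n) ^ 2 * ln 2 - sqrt (real n) / 2)) \<longlonglongrightarrow> 0" by real_asymp
  show "\<forall>\<^sub>F n in sequentially. prob {\<omega>\<in>space M. order_stat (\<lambda>i. E i \<omega>) n (n - k n) \<le> ln (real n) / 2} \<le>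
      exp (ln (real n) ^ 2 * ln 2 - sqrt (real n) / 2)"
    using small eventually_ge_at_top[of 2]
  proof eventually_elim
    case (elim n)
    define r where "r = sqrt (real n)"
    have r: "r \<ge> 1" "r * r = real n" using elim by (auto simp: r_def)
    have "exp (- (ln (real n) / 2)) = 1 / r"
      using elim by (simp add: r_def exp_minus powr_half_sqrt[symmetric] powr_def inverse_eq_divide)
    then have "prob {\<omega>\<in>space M. order_stat (\<lambda>i. E i \<omega>) n (n - k n) \<le> ln (real n) / 2} \<le> 2 ^ k n * (1 - 1 / r / 2) ^ n"
      using prob_order_stat_exponential_le[OF indep_vars_subset[OF indep, of "{1..n}"] E, of "k n" "ln (real n) / 2"]
        k[OF elim(2)] elim by auto
    also have "\<dots> \<le> exp (ln (real n) ^ 2 * ln 2) * exp (- (1 / r / 2)) ^ n"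
    proof (intro mult_mono power_mono)
      have "(2::real) ^ k n = exp (real (k n) * ln 2)"
        by (simp add: exp_of_nat_mult)
      also have "\<dots> \<le> exp (ln (real n) ^ 2 * ln 2)" using elim by simp
      finally show "(2::real) ^ k n \<le> exp (ln (real n) ^ 2 * ln 2)" .
      show "1 - 1 / r / 2 \<le> exp (- (1 / r / 2))" using exp_ge_add_one_self[of "- (1 / r / 2)"] by simp
      show "0 \<le> 1 - 1 / r / 2" using r by (simp add: field_simps)
      then show "0 \<le> (1 - 1 / r / 2) ^ n" by simp
    qed simp
    also have "exp (- (1 / r / 2)) ^ n = exp (- (r / 2))"
    proof -
      have "real n * (- (1 / r / 2)) = - (r / 2)" unfolding r(2)[symmetric] using r(1) by simp
      then show ?thesis by (simp only: exp_of_nat_mult[symmetric])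
    qed
    also have "exp (ln (real n) ^ 2 * ln 2) * exp (- (r / 2)) = exp (ln (real n) ^ 2 * ln 2 - sqrt (real n) / 2)"
      unfolding r_def exp_add[symmetric] by simp
    finally show ?case .
  qed
qed (simp add: always_eventually)

section \<open>Asymptotic normality of the Hill estimator\<close>

theorem theorem1:
  fixes M :: "'a measure" and X :: "nat \<Rightarrow> 'a \<Rightarrow> real" and k :: "nat \<Rightarrow> nat"
    and \<theta> \<beta> \<gamma> :: real
  assumes "\<theta> > 0" and "\<beta> > 1" and "\<gamma> = 1 / \<theta>"
    and "prob_space M"
    and "prob_space.indep_vars M (\<lambda>_. borel) X {1..}"
    and "\<And>i. i \<ge> 1 \<Longrightarrow> cdf (distr M borel (X i)) = cdf (pseudo_lindley \<theta> \<beta>)"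
    and "\<And>n. n \<ge> 2 \<Longrightarrow> 1 \<le> k n \<and> k n < n"
    and "filterlim k at_top sequentially"
    and "(\<lambda>n. real (k n) powr (3 / 4) / ln (real n)) \<longlonglongrightarrow> 0"
  shows "weak_conv_m
           (\<lambda>n. distr M borel (\<lambda>\<omega>. sqrt (real (k n)) * (hill (\<lambda>i. X i \<omega>) n (k n) - \<gamma>)))
           (density lborel (\<lambda>x. ennreal (normal_density 0 \<gamma> x)))"
proof -
  interpret prob_space M by fact
  note \<theta> = assms(1) and \<beta> = assms(2) and k = assms(7)
  have \<gamma>: "\<gamma> > 0" "\<gamma> * \<theta> = 1" using assms(1,3) by simp_all
  define E where "E = (\<lambda>i \<omega>. cumulative_hazard \<theta> \<beta> (X i \<omega>))"
  define HE where "HE = (\<lambda>n \<omega>. hill (\<lambda>i. E i \<omega>) n (k n))"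
  define HX where "HX = (\<lambda>n \<omega>. hill (\<lambda>i. X i \<omega>) n (k n))"
  have hazard_measurable: "cumulative_hazard \<theta> \<beta> \<in> borel_measurable borel"
    unfolding cumulative_hazard_def[abs_def] by measurable
  have X [measurable]: "X i \<in> borel_measurable M" if "i \<ge> 1" for i
    using assms(5) that by (auto simp: indep_vars_def)
  have E: "distributed M lborel (E i) (exponential_density 1)" if "i \<ge> 1" for i
    unfolding E_def by (intro distributed_cumulative_hazard \<theta> \<beta> assms(4,6) X that)
  have rvE: "E i \<in> borel_measurable M" if "i \<ge> 1" for i
    using distributed_measurable[OF E[OF that]] by simp
  have indepE: "indep_vars (\<lambda>_. borel) E {1..}"
    unfolding E_def by (rule indep_vars_compose2[OF assms(5)]) (rule hazard_measurable)
  have growth: "(\<lambda>n. sqrt (real (k n)) / ln (real n)) \<longlonglongrightarrow> 0"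
    "\<forall>\<^sub>F n in sequentially. real (k n) \<le> ln (real n) ^ 2"
    using intermediate_growth[OF _ assms(9)] k by auto
  define p where "p = (\<lambda>n. prob {\<omega>\<in>space M. order_stat (\<lambda>i. E i \<omega>) n (n - k n) \<le> ln (real n) / 2})"
  define G where "G = (\<lambda>n y. prob {\<omega>\<in>space M. sqrt (real (k n)) * (HE n \<omega> - 1) \<le> y / \<gamma>})"
  let ?N = "density lborel (\<lambda>x. ennreal (normal_density 0 \<gamma> x))"
  have p: "p \<longlonglongrightarrow> 0"
    unfolding p_def by (rule order_stat_exponential_at_log_scale[OF indepE E k growth(2)])
  have G: "(\<lambda>n. G n y) \<longlonglongrightarrow> cdf ?N y" for y
    unfolding G_def HE_def cdf_normal_scale[OF \<gamma>(1)]
    by (rule CLT_hill_exponential[OF indepE E k assms(8)])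
  have HE_meas: "HE n \<in> borel_measurable M" and HX_meas: "HX n \<in> borel_measurable M"
    and order_meas: "(\<lambda>\<omega>. order_stat (\<lambda>i. E i \<omega>) n (n - k n)) \<in> borel_measurable M"
    if "n \<ge> 2" for n
    using k[OF that] X rvE unfolding HE_def HX_def
    by (auto intro!: borel_measurable_hill borel_measurable_order_stat)
  show ?thesis
    unfolding weak_conv_m_def weak_conv_def
  proof (intro allI impI)
    fix x assume cont: "isCont (cdf ?N) x"
    define F where "F = (\<lambda>n. prob {\<omega>\<in>space M. sqrt (real (k n)) * (HX n \<omega> - \<gamma>) \<le> x})"
    have "F \<longlonglongrightarrow> cdf ?N x"
    proof (rule squeeze_shifted_cdfs[OF G p cont])
      show "\<forall>\<^sub>F n in sequentially. F n \<le> G n x"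
        using eventually_ge_at_top[of 2]
      proof eventually_elim
        case (elim n)
        note [measurable] = HE_meas[OF elim] HX_meas[OF elim]
        show ?case
          unfolding F_def G_def
        proof (rule finite_measure_mono)
          show "{\<omega>\<in>space M. sqrt (real (k n)) * (HX n \<omega> - \<gamma>) \<le> x} \<subseteq>
            {\<omega>\<in>space M. sqrt (real (k n)) * (HE n \<omega> - 1) \<le> x / \<gamma>}"
          proof safe
            fix \<omega> assume le: "sqrt (real (k n)) * (HX n \<omega> - \<gamma>) \<le> x"
            have "HE n \<omega> \<le> \<theta> * HX n \<omega>"
              unfolding HE_def HX_def E_def 
              by (intro hill_cumulative_hazard_le \<theta> \<beta> conjunct2[OF k[OF elim]])
            also have "\<dots> = (HX n \<omega> - \<gamma>) / \<gamma> + 1"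
              unfolding assms(3) using assms(1) by (simp add: field_simps)
            finally have "HE n \<omega> - 1 \<le> (HX n \<omega> - \<gamma>) / \<gamma>" by simp
            then have "sqrt (real (k n)) * (HE n \<omega> - 1) \<le> sqrt (real (k n)) * ((HX n \<omega> - \<gamma>) / \<gamma>)"
              by (intro mult_left_mono) auto
            also have "\<dots> \<le> x / \<gamma>" using le \<gamma>(1) by (simp add: divide_right_mono)
            finally show "sqrt (real (k n)) * (HE n \<omega> - 1) \<le> x / \<gamma>" .
          qed
        qed measurable
      qed
    next
      fix \<epsilon> :: real assume \<epsilon>: "\<epsilon> > 0"
      \<comment> \<open>The bias of the estimator is at most \<open>\<gamma> * (2 / ln n)\<close> times the exponential Hill statistic,
        and on the event considered that statistic is at most \<open>1 + \<bar>x\<bar> / \<gamma>\<close>.\<close>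
      define C where "C = 2 * \<gamma> * (1 + \<bar>x\<bar> / \<gamma>)"
      have C: "C > 0" using \<gamma>(1) by (simp add: C_def add_pos_nonneg)
      have large: "\<forall>\<^sub>F n in sequentially. 1 \<le> ln (real n)" by real_asymp
      have small: "\<forall>\<^sub>F n in sequentially. sqrt (real (k n)) / ln (real n) < \<epsilon> / C"
        using order_tendstoD(2)[OF growth(1), of "\<epsilon> / C"] \<epsilon> C by simp
      show "\<forall>\<^sub>F n in sequentially. G n (x - \<epsilon>) - p n \<le> F n"
        using eventually_ge_at_top[of 2] large small
      proof eventually_elim
        case (elim n)
        note [measurable] = HE_meas[OF elim(1)] HX_meas[OF elim(1)] order_meas[OF elim(1)]
        define v where "v = ln (real n) / 2"
        have v: "v > 0" using elim(2) by (simp add: v_def)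
        have s1: "1 \<le> sqrt (real (k n))" using k[OF elim(1)] by simp
        let ?A = "{\<omega>\<in>space M. order_stat (\<lambda>i. E i \<omega>) n (n - k n) \<le> ln (real n) / 2}"
        let ?B = "{\<omega>\<in>space M. sqrt (real (k n)) * (HX n \<omega> - \<gamma>) \<le> x}"
        have "G n (x - \<epsilon>) \<le> prob (?A \<union> ?B)"
          unfolding G_def
        proof (rule finite_measure_mono)
          show "{\<omega>\<in>space M. sqrt (real (k n)) * (HE n \<omega> - 1) \<le> (x - \<epsilon>) / \<gamma>} \<subseteq> ?A \<union> ?B"
          proof safe
            fix \<omega> assume le: "sqrt (real (k n)) * (HE n \<omega> - 1) \<le> (x - \<epsilon>) / \<gamma>"
              and \<omega>: "\<omega> \<in> space M" and nB: "\<not> sqrt (real (k n)) * (HX n \<omega> - \<gamma>) \<le> x"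
            show "order_stat (\<lambda>i. E i \<omega>) n (n - k n) \<le> ln (real n) / 2"
            proof (rule ccontr)
              assume "\<not> ?thesis"
              then have "\<theta> * HX n \<omega> \<le> (1 + 1 / v) * HE n \<omega>"
                unfolding HX_def HE_def E_def v_def[symmetric]
                by (intro hill_le_hill_cumulative_hazard \<theta> \<beta> v conjunct2[OF k[OF elim(1)]])
                  (simp add: E_def v_def)
              then have "\<gamma> * (\<theta> * HX n \<omega>) \<le> \<gamma> * ((1 + 1 / v) * HE n \<omega>)"
                using \<gamma>(1) by (intro mult_left_mono) auto
              then have HX: "HX n \<omega> - \<gamma> \<le> \<gamma> * (HE n \<omega> - 1) + \<gamma> / v * HE n \<omega>"
                using \<gamma>(2) by (simp add: mult.assoc[symmetric]) (simp add: algebra_simps)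
              have "HE n \<omega> \<le> 1 + \<bar>x\<bar> / \<gamma>"
              proof (cases "HE n \<omega> \<le> 1")
                case False
                then have "1 * (HE n \<omega> - 1) \<le> sqrt (real (k n)) * (HE n \<omega> - 1)"
                  using s1 by (intro mult_right_mono) auto
                also have "\<dots> \<le> (x - \<epsilon>) / \<gamma>" by (rule le)
                also have "\<dots> \<le> \<bar>x\<bar> / \<gamma>" using \<gamma>(1) \<epsilon> by (intro divide_right_mono) auto
                finally show ?thesis by simp
              qed (use \<gamma>(1) in \<open>auto intro: order_trans[of _ 1]\<close>)
              then have "\<gamma> / v * HE n \<omega> \<le> \<gamma> / v * (1 + \<bar>x\<bar> / \<gamma>)"
                using \<gamma>(1) v by (intro mult_left_mono) auto
              also have "\<dots> = C / ln (real n)" by (simp add: C_def v_def)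
              finally have "HX n \<omega> - \<gamma> \<le> \<gamma> * (HE n \<omega> - 1) + C / ln (real n)" using HX by simp
              then have "sqrt (real (k n)) * (HX n \<omega> - \<gamma>) \<le>
                  sqrt (real (k n)) * (\<gamma> * (HE n \<omega> - 1) + C / ln (real n))"
                by (intro mult_left_mono) auto
              also have "\<dots> = \<gamma> * (sqrt (real (k n)) * (HE n \<omega> - 1)) + C * (sqrt (real (k n)) / ln (real n))"
                by (simp add: algebra_simps)
              also have "\<dots> \<le> \<gamma> * ((x - \<epsilon>) / \<gamma>) + C * (\<epsilon> / C)"
                using le \<gamma>(1) C elim(3) by (intro add_mono mult_left_mono) auto
              also have "\<dots> = x" using \<gamma>(1) C by simp
              finally show False using nB by simp
            qed
          qed
        qed measurable
        also have "\<dots> \<le> prob ?A + prob ?B"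
          by (rule measure_Un_le) measurable
        finally show ?case by (simp add: p_def F_def)
      qed
    qed
    moreover have "\<forall>\<^sub>F n in sequentially. F n =
        cdf (distr M borel (\<lambda>\<omega>. sqrt (real (k n)) * (hill (\<lambda>i. X i \<omega>) n (k n) - \<gamma>))) x"
      using eventually_ge_at_top[of 2]
    proof eventually_elim
      case (elim n)
      note [measurable] = HX_meas[OF elim, unfolded HX_def]
      show ?case
        unfolding F_def HX_def cdf_def
        by (subst measure_distr) (auto intro!: arg_cong[where f = prob])
    qed
    ultimately show "(\<lambda>n. cdf (distr M borel (\<lambda>\<omega>. sqrt (real (k n)) * (hill (\<lambda>i. X i \<omega>) n (k n) - \<gamma>))) x)
        \<longlonglongrightarrow> cdf ?N x"
      by (rule Lim_transform_eventually)
  qed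
qed

end
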